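(* Any rotational hypersurface $(M,\bar h,J)$ of type III in $\mathbb C^n\times\mathbb R$ ($\dim M=2n\ge4$, with $t(s)>0$, $t'(s)\le-1$ for $s\in I$), whose Kähler metric $$g=\bar h+(1-t')(\bar\eta\otimes\bar\eta+\tilde{\bar\eta}\otimes\tilde{\bar\eta})$$ is of constant holomorphic sectional curvatures $a=\mathrm{const}<0$, is generated by a meridian of the type $$\gamma:\ q=\frac{1}{-a}\left(\sqrt{a(8+at^2)}-2\sqrt{-a}\,\arctan\tfrac12\sqrt{-(8+at^2)}\right),\qquad t>\frac{2\sqrt2}{\sqrt{-a}},$$ in the hyperbolic plane $O\mathbf{ne}$.
   Context: Rotational hypersurfaces of type III: let $(\mathbb C^n,h',J_0)$ be the flat Kähler-Lorentz space with standard complex structure $J_0$ and $h'(\mathbf Z,\mathbf Z)=|z^1|^2+\dots+|z^{n-1}|^2-|z^n|^2$, and let $\mathbb R$ be spanned by $\mathbf e$ with $\mathbf e^2=+1$; the product metric on $\mathbb C^n\times\mathbb R$ is also denoted $h'$. For smooth functions $t(s)>0$, $q(s)$ on an interval $I$, the rotational hypersurface $M$ (having no common points with the axis of revolution $\mathbb R$) consists of the points $\mathbf Z=t(s)\mathbf n+q(s)\mathbf e$, $s\in I$, $\mathbf n\in\mathbb C^n$ with $h'(\mathbf n,\mathbf n)=-1$; its meridian is $\gamma:\mathbf z(s)=t(s)\mathbf n+q(s)\mathbf e$ ($\mathbf n$ fixed), a curve in the plane $O\mathbf{ne}$ through the origin $O$ spanned by $\mathbf n,\mathbf e$ (the "hyperbolic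 plane", with indefinite metric), which can be written in the form $q=q(t)$. $M$ is of type III if its normals are space-like; then the meridian is time-like, $s$ is taken to be a natural parameter, $-t'^2+q'^2=-1$, so $t'^2\ge1$, and the meridians are oriented so that $t'\le-1$. Structures on $M$: $\bar h$ is the induced metric, of signature $(2(n-1),2)$; $\bar\xi=\partial\mathbf Z/\partial s$; $\tilde{\bar\xi}=J_0\mathbf n$; $\bar\eta=\bar h(\bar\xi,\cdot)$, $\tilde{\bar\eta}=\bar h(\tilde{\bar\xi},\cdot)$; $D$ is the $\bar h$-orthogonal complement of $\mathrm{span}\{\bar\xi,\tilde{\bar\xi}\}$ in $TM$; the almost complex structure $J$ is given by $J|_D=J_0$, $J\bar\xi=\tilde{\bar\xi}$, $J\tilde{\bar\xi}=-\bar\xi$. The metric $g$ is positive definite and Kähler with respect to $J$.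
   Formalization: The meridian equation is proved up to a sign and an additive constant, q = ±(…) + c, since reflecting or translating along the axis preserves all hypotheses; the interval I is taken open, since at an endpoint with t' = −1 the strict bound on t fails. *)

theory Defs
  imports "HOL-Analysis.Analysis"
begin

text \<open>Smoothness on an open set: \<open>Ck_on k S f\<close> says that \<open>f\<close> is of class $C^k$ on \<open>S\<close>.\<close>

primrec Ck_on :: "nat \<Rightarrow> 'a::euclidean_space set \<Rightarrow> ('a \<Rightarrow> 'b::real_normed_vector) \<Rightarrow> bool" where
  "Ck_on 0 S f \<longleftrightarrow> continuous_on S f"
| "Ck_on (Suc k) S f \<longleftrightarrow>
     (\<forall>x\<in>S. f differentiable (at x)) \<and> (\<forall>v. Ck_on k S (\<lambda>x. frechet_derivative f (at x) v))"

definition smooth_on :: "'a::euclidean_space set \<Rightarrow> ('a \<Rightarrow> 'b::real_normed_vector) \<Rightarrow> bool" where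
  "smooth_on S f \<longleftrightarrow> (\<forall>k. Ck_on k S f)"


text \<open>
  Riemannian geometry in a chart. A metric on an open subset of a Euclidean space \<open>'a\<close> is a family
  of symmetric bilinear forms \<open>G x\<close>; the vectors \<open>u, v, w\<close> stand for constant vector fields.
\<close>

text \<open>The Levi-Civita derivative \<open>\<nabla>\<^sub>u v\<close> of constant fields, given by the Koszul formula.\<close>

definition levi_civita :: "('a::euclidean_space \<Rightarrow> 'a \<Rightarrow> 'a \<Rightarrow> real) \<Rightarrow> 'a \<Rightarrow> 'a \<Rightarrow> 'a \<Rightarrow> 'a" where
  "levi_civita G x u v =
     (THE w. \<forall>y. 2 * G x w y =
          frechet_derivative (\<lambda>x. G x v y) (at x) u
        + frechet_derivative (\<lambda>x. G x u y) (at x) v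
        - frechet_derivative (\<lambda>x. G x u v) (at x) y)"

text \<open>\<open>R(u, v) w = \<nabla>\<^sub>u \<nabla>\<^sub>v w - \<nabla>\<^sub>v \<nabla>\<^sub>u w\<close>; the bracket of constant fields vanishes.\<close>

definition riemann_curvature ::
    "('a::euclidean_space \<Rightarrow> 'a \<Rightarrow> 'a \<Rightarrow> real) \<Rightarrow> 'a \<Rightarrow> 'a \<Rightarrow> 'a \<Rightarrow> 'a \<Rightarrow> 'a" where
  "riemann_curvature G x u v w =
       frechet_derivative (\<lambda>x. levi_civita G x v w) (at x) u
     + levi_civita G x u (levi_civita G x v w)
     - frechet_derivative (\<lambda>x. levi_civita G x u w) (at x) v
     - levi_civita G x v (levi_civita G x u w)"

definition sectional_curvature ::
    "('a::euclidean_space \<Rightarrow> 'a \<Rightarrow> 'a \<Rightarrow> real) \<Rightarrow> 'a \<Rightarrow> 'a \<Rightarrow> 'a \<Rightarrow> real" where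
  "sectional_curvature G x u v =
     G x (riemann_curvature G x u v v) u / (G x u u * G x v v - (G x u v)\<^sup>2)"


text \<open>
  The ambient space $\mathbb{C}^n \times \mathbb{R}$, where $n$ is the cardinality of \<open>'n\<close> and the
  index \<open>\<nu>\<close> is the one that carries the minus sign in \<open>h'\<close>.
\<close>

type_synonym 'n ambient = "(complex ^ 'n) \<times> real"

definition lorentz_product :: "'n::finite \<Rightarrow> 'n ambient \<Rightarrow> 'n ambient \<Rightarrow> real" where
  "lorentz_product \<nu> X Y =
     (\<Sum>i\<in>UNIV - {\<nu>}. Re (fst X $ i * cnj (fst Y $ i))) - Re (fst X $ \<nu> * cnj (fst Y $ \<nu>))
     + snd X * snd Y"

definition unit_hyperboloid :: "'n::finite \<Rightarrow> (complex ^ 'n) set" where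
  "unit_hyperboloid \<nu> = {n. lorentz_product \<nu> (n, 0) (n, 0) = - 1}"

definition rotational_point :: "(real \<Rightarrow> real) \<Rightarrow> (real \<Rightarrow> real) \<Rightarrow> real \<Rightarrow> complex ^ 'n::finite \<Rightarrow> 'n ambient" where
  "rotational_point t q s n = (t s *\<^sub>R n, q s)"

definition rotational_hypersurface ::
    "'n::finite \<Rightarrow> (real \<Rightarrow> real) \<Rightarrow> (real \<Rightarrow> real) \<Rightarrow> real set \<Rightarrow> 'n ambient set" where
  "rotational_hypersurface \<nu> t q I = {rotational_point t q s n | s n. s \<in> I \<and> n \<in> unit_hyperboloid \<nu>}"

definition tangent_space :: "'n::finite ambient set \<Rightarrow> 'n ambient \<Rightarrow> 'n ambient set" where
  "tangent_space M p =
     {X. \<exists>\<gamma>. \<gamma> 0 = p \<and> (\<forall>\<^sub>F \<tau> in nhds (0::real). \<gamma> \<tau> \<in> M) \<and> (\<gamma> has_vector_derivative X) (at 0)}"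

definition spacelike_normals :: "'n::finite \<Rightarrow> 'n ambient set \<Rightarrow> bool" where
  "spacelike_normals \<nu> M \<longleftrightarrow>
     (\<forall>p\<in>M. \<forall>N. N \<noteq> 0 \<and> (\<forall>X\<in>tangent_space M p. lorentz_product \<nu> N X = 0)
        \<longrightarrow> lorentz_product \<nu> N N > 0)"

definition type_III ::
    "'n::finite \<Rightarrow> (real \<Rightarrow> real) \<Rightarrow> (real \<Rightarrow> real) \<Rightarrow> real set \<Rightarrow> bool" where
  "type_III \<nu> t q I \<longleftrightarrow>
     open I \<and> is_interval I \<and> smooth_on I t \<and> smooth_on I q
     \<and> (\<forall>s\<in>I. t s > 0)
     \<and> spacelike_normals \<nu> (rotational_hypersurface \<nu> t q I)
     \<and> (\<forall>s\<in>I. - (deriv t s)\<^sup>2 + (deriv q s)\<^sup>2 = - 1)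
     \<and> (\<forall>s\<in>I. deriv t s \<le> - 1)"


text \<open>
  The structures on $M$. Tangent vectors are vectors of the ambient space, so the induced metric is
  the restriction of \<open>lorentz_product \<nu>\<close>. The parameters \<open>s\<close> and \<open>n\<close> of a point of $M$ are
  unique when \<open>t\<close> is positive and injective, in particular in type III;
  see \<open>param_s_eq\<close>, \<open>param_n_eq\<close>.
\<close>

definition param_s ::
    "'n::finite \<Rightarrow> (real \<Rightarrow> real) \<Rightarrow> (real \<Rightarrow> real) \<Rightarrow> real set \<Rightarrow> 'n ambient \<Rightarrow> real" where
  "param_s \<nu> t q I p = (THE s. s \<in> I \<and> (\<exists>n\<in>unit_hyperboloid \<nu>. p = rotational_point t q s n))"

definition param_n ::
    "'n::finite \<Rightarrow> (real \<Rightarrow> real) \<Rightarrow> (real \<Rightarrow> real) \<Rightarrow> real set \<Rightarrow> 'n ambient \<Rightarrow> complex ^ 'n" where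
  "param_n \<nu> t q I p =
     (THE n. n \<in> unit_hyperboloid \<nu> \<and> (\<exists>s\<in>I. p = rotational_point t q s n))"

text \<open>\<open>xi\<close> is $\bar\xi = \partial \mathbf{Z} / \partial s$ and \<open>xi_tilde\<close> is $J_0 \mathbf{n}$.\<close>

definition xi where
  "xi \<nu> t q I p =
     (deriv t (param_s \<nu> t q I p) *\<^sub>R param_n \<nu> t q I p, deriv q (param_s \<nu> t q I p))"

definition J0 :: "'n::finite ambient \<Rightarrow> 'n ambient" where
  "J0 X = (\<i> *s fst X, 0)"

definition xi_tilde where
  "xi_tilde \<nu> t q I p = J0 (param_n \<nu> t q I p, 0)"

definition eta where
  "eta \<nu> t q I p X = lorentz_product \<nu> (xi \<nu> t q I p) X"

definition eta_tilde where
  "eta_tilde \<nu> t q I p X = lorentz_product \<nu> (xi_tilde \<nu> t q I p) X"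

text \<open>The fibre of $D$ at \<open>p\<close>. It lies in $\mathbb{C}^n \times \{0\}$, so \<open>J0\<close> makes sense on it.\<close>

definition distribution_D where
  "distribution_D \<nu> t q I p =
     {X \<in> tangent_space (rotational_hypersurface \<nu> t q I) p.
        lorentz_product \<nu> (xi \<nu> t q I p) X = 0 \<and> lorentz_product \<nu> (xi_tilde \<nu> t q I p) X = 0}"

text \<open>
  Since $\bar\xi$, $\tilde{\bar\xi}$ are orthogonal time-like unit vectors, \<open>X\<close> has the components
  \<open>- eta X\<close> and \<open>- eta_tilde X\<close> along them, and \<open>proj_D\<close> is the orthogonal projection to $D$.
  The defining properties of $J$ are \<open>almost_complex_J_D\<close>, \<open>almost_complex_J_xi\<close> and
  \<open>almost_complex_J_xi_tilde\<close>.
\<close>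

definition proj_D where
  "proj_D \<nu> t q I p X =
     X + eta \<nu> t q I p X *\<^sub>R xi \<nu> t q I p + eta_tilde \<nu> t q I p X *\<^sub>R xi_tilde \<nu> t q I p"

definition almost_complex_J where
  "almost_complex_J \<nu> t q I p X =
     J0 (proj_D \<nu> t q I p X)
     - eta \<nu> t q I p X *\<^sub>R xi_tilde \<nu> t q I p
     + eta_tilde \<nu> t q I p X *\<^sub>R xi \<nu> t q I p"

definition kaehler_metric where
  "kaehler_metric \<nu> t q I p X Y =
     lorentz_product \<nu> X Y
     + (1 - deriv t (param_s \<nu> t q I p)) *
         (eta \<nu> t q I p X * eta \<nu> t q I p Y + eta_tilde \<nu> t q I p X * eta_tilde \<nu> t q I p Y)"

text \<open>
  Local parametrizations of the $2n$-dimensional $M$ by open subsets of \<open>complex ^ 'n\<close>, used merely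
  as a model of $\mathbb{R}^{2n}$ (no compatibility with complex structures). An immersion between
  manifolds of equal dimension is a local diffeomorphism.
\<close>

definition local_parametrization ::
    "'n::finite ambient set \<Rightarrow> (complex ^ 'n) set \<Rightarrow> (complex ^ 'n \<Rightarrow> 'n ambient) \<Rightarrow> bool" where
  "local_parametrization M U \<phi> \<longleftrightarrow>
     open U \<and> smooth_on U \<phi> \<and> \<phi> ` U \<subseteq> M \<and> inj_on \<phi> U
     \<and> (\<forall>x\<in>U. inj (frechet_derivative \<phi> (at x)))"

definition pullback_metric ::
    "(complex ^ 'n \<Rightarrow> 'n::finite ambient) \<Rightarrow> ('n ambient \<Rightarrow> 'n ambient \<Rightarrow> 'n ambient \<Rightarrow> real)
      \<Rightarrow> complex ^ 'n \<Rightarrow> complex ^ 'n \<Rightarrow> complex ^ 'n \<Rightarrow> real" where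
  "pullback_metric \<phi> g x u v =
     g (\<phi> x) (frechet_derivative \<phi> (at x) u) (frechet_derivative \<phi> (at x) v)"

text \<open>
  All sectional curvatures of the planes $\mathrm{span}\{X, JX\}$ are equal to \<open>a\<close>. Here
  $X = d\varphi_x(u)$, and \<open>v\<close> represents $JX$ in the chart.
\<close>

definition constant_holomorphic_curvature ::
    "'n::finite ambient set \<Rightarrow> ('n ambient \<Rightarrow> 'n ambient \<Rightarrow> 'n ambient \<Rightarrow> real)
      \<Rightarrow> ('n ambient \<Rightarrow> 'n ambient \<Rightarrow> 'n ambient) \<Rightarrow> real \<Rightarrow> bool" where
  "constant_holomorphic_curvature M g J a \<longleftrightarrow>
     (\<forall>U \<phi>. local_parametrization M U \<phi> \<longrightarrow>
        (\<forall>x\<in>U. \<forall>u v. u \<noteq> 0 \<and>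
           frechet_derivative \<phi> (at x) v = J (\<phi> x) (frechet_derivative \<phi> (at x) u) \<longrightarrow>
           sectional_curvature (pullback_metric \<phi> g) x u v = a))"


lemma lorentz_product_scaleR_fst:
  "lorentz_product \<nu> (r *\<^sub>R n, 0) (r *\<^sub>R n, 0) = r\<^sup>2 * lorentz_product \<nu> (n, 0) (n, 0)"
  by (simp add: lorentz_product_def sum_distrib_left right_diff_distrib power2_eq_square algebra_simps)

lemma rotational_point_inj:
  assumes "\<forall>s\<in>I. t s > 0" "inj_on t I" "s \<in> I" "s' \<in> I"
    and "n \<in> unit_hyperboloid \<nu>" "n' \<in> unit_hyperboloid \<nu>"
    and "rotational_point t q s n = rotational_point t q s' n'"
  shows "s = s' \<and> n = n'"
proof -
  have eq: "t s *\<^sub>R n = t s' *\<^sub>R n'" using assms(7) by (simp add: rotational_point_def)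
  then have "(t s)\<^sup>2 = (t s')\<^sup>2"
    using lorentz_product_scaleR_fst[of \<nu> "t s" n] lorentz_product_scaleR_fst[of \<nu> "t s'" n'] assms(5,6)
    by (simp add: unit_hyperboloid_def)
  then have "t s = t s'" using assms(1,3,4) by (simp add: power2_eq_iff_nonneg less_imp_le)
  then have s: "s = s'" using assms(2-4) by (auto dest: inj_onD)
  have "t s > 0" using assms(1,3) by blast
  then have "n = n'" using eq s by simp
  with s show ?thesis by blast
qed

lemma param_s_eq:
  assumes "\<forall>s\<in>I. t s > 0" "inj_on t I" "s \<in> I" "n \<in> unit_hyperboloid \<nu>"
  shows "param_s \<nu> t q I (rotational_point t q s n) = s"
  unfolding param_s_def using assms rotational_point_inj[OF assms(1,2)] by (intro the_equality) blast+

lemma param_n_eq: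
  assumes "\<forall>s\<in>I. t s > 0" "inj_on t I" "s \<in> I" "n \<in> unit_hyperboloid \<nu>"
  shows "param_n \<nu> t q I (rotational_point t q s n) = n"
  unfolding param_n_def using assms rotational_point_inj[OF assms(1,2)] by (intro the_equality) blast+

lemma almost_complex_J_D:
  "X \<in> distribution_D \<nu> t q I p \<Longrightarrow> almost_complex_J \<nu> t q I p X = J0 X"
  by (simp add: distribution_D_def almost_complex_J_def proj_D_def eta_def eta_tilde_def)

lemma J0_zero: "J0 0 = 0"
  by (simp add: J0_def vec_eq_iff zero_prod_def)

lemma lorentz_product_xi:
  assumes "param_n \<nu> t q I p \<in> unit_hyperboloid \<nu>"
    and "- (deriv t (param_s \<nu> t q I p))\<^sup>2 + (deriv q (param_s \<nu> t q I p))\<^sup>2 = - 1"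
  shows "lorentz_product \<nu> (xi \<nu> t q I p) (xi \<nu> t q I p) = - 1"
proof -
  have "lorentz_product \<nu> (r *\<^sub>R n, b) (r *\<^sub>R n, b) = r\<^sup>2 * lorentz_product \<nu> (n, 0) (n, 0) + b\<^sup>2"
    for r b n
    using lorentz_product_scaleR_fst[of \<nu> r n] by (simp add: lorentz_product_def power2_eq_square)
  then show ?thesis using assms by (simp add: xi_def unit_hyperboloid_def)
qed

lemma lorentz_product_xi_tilde:
  assumes "param_n \<nu> t q I p \<in> unit_hyperboloid \<nu>"
  shows "lorentz_product \<nu> (xi_tilde \<nu> t q I p) (xi_tilde \<nu> t q I p) = - 1"
  using assms
  by (simp add: xi_tilde_def J0_def unit_hyperboloid_def lorentz_product_def add.commute)

lemma lorentz_product_xi_xi_tilde: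
  "lorentz_product \<nu> (xi \<nu> t q I p) (xi_tilde \<nu> t q I p) = 0"
  "lorentz_product \<nu> (xi_tilde \<nu> t q I p) (xi \<nu> t q I p) = 0"
  by (simp_all add: xi_def xi_tilde_def J0_def lorentz_product_def algebra_simps)

lemma almost_complex_J_xi:
  assumes "param_n \<nu> t q I p \<in> unit_hyperboloid \<nu>"
    and "- (deriv t (param_s \<nu> t q I p))\<^sup>2 + (deriv q (param_s \<nu> t q I p))\<^sup>2 = - 1"
  shows "almost_complex_J \<nu> t q I p (xi \<nu> t q I p) = xi_tilde \<nu> t q I p"
  using lorentz_product_xi[OF assms]
  by (simp add: almost_complex_J_def proj_D_def eta_def eta_tilde_def lorentz_product_xi_xi_tilde J0_zero)

lemma almost_complex_J_xi_tilde:
  assumes "param_n \<nu> t q I p \<in> unit_hyperboloid \<nu>"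
  shows "almost_complex_J \<nu> t q I p (xi_tilde \<nu> t q I p) = - xi \<nu> t q I p"
  using lorentz_product_xi_tilde[OF assms]
  by (simp add: almost_complex_J_def proj_D_def eta_def eta_tilde_def lorentz_product_xi_xi_tilde J0_zero)

end

theory Submission
  imports Defs
begin

text \<open>
  It suffices to compute the holomorphic sectional curvature of a single plane in $D$ at each point.
  In a suitable $U(n-1,1)$-equivariant chart the Kaehler metric is
  $A h' + B h'(z, \cdot)^2 + C h'(iz, \cdot)^2$ with $A$, $B$, $C$ functions of $\rho = -h'(z, z)$,
  and its Levi-Civita connection can be written down explicitly. The curvature of a horizontal
  holomorphic plane is $-4 (1 - t') / t^2$, so that $t' = 1 + a t^2 / 4$.
  Since $t$ decreases strictly and $I$ is open, $t' \le -1$ forces $t' < -1$. Hence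
  $q'^2 = t'^2 - 1$ does not vanish, and $q'$ has constant sign. The given function of $t$ has the
  same squared derivative, so it differs from $\pm q$ by a constant.
\<close>

section \<open>Calculus of smooth functions\<close>

text \<open>Constant holomorphic curvature is a condition on all local parametrizations, so around
  each point the most convenient chart may be tested. The plane is taken in D because horizontal
  directions are tangent to the level sets of \<open>rho\<close>: to first order the coefficients A,
  B, C do not change along them, and the curvature involves neither a derivative of B or C nor a
  second derivative of A. As A contains only t, while B and C contain t', the condition is a
  first-order equation for t, with no t'' in it. The bound 2 sqrt 2 / sqrt (-a) is the value of t at
  which 1 + a t^2 / 4 = -1. The sign and the additive constant in front of and after the given
  function are inherent: reflecting the axis or translating along it changes neither t nor the
  curvature.\<close>

lemma frechet_derivative_cong_open:
  assumes "open S" "x \<in> S" "\<And>y. y \<in> S \<Longrightarrow> f y = g y"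
  shows "frechet_derivative f (at x) = frechet_derivative g (at x)"
proof -
  \<comment> \<open>\<open>frechet_derivative\<close> is a choice from the set of derivatives; the
    two sets coincide, so the choices agree even where this set is empty.\<close>
  have "(f has_derivative D) (at x) \<longleftrightarrow> (g has_derivative D) (at x)" for D
    using has_derivative_transform_within_open[of f D x UNIV S g]
      has_derivative_transform_within_open[of g D x UNIV S f] assms by auto
  then show ?thesis by (simp add: frechet_derivative_def)
qed

lemma frechet_derivative_eq:
  "(f has_derivative f') (at x) \<Longrightarrow> frechet_derivative f (at x) = f'"
  by (rule frechet_derivative_at[symmetric])

lemma differentiable_cong_open:
  assumes "open S" "x \<in> S" "\<And>y. y \<in> S \<Longrightarrow> f y = g y"
  shows "f differentiable (at x) \<longleftrightarrow> g differentiable (at x)"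
  using has_derivative_transform_within_open[of f _ x UNIV S g]
    has_derivative_transform_within_open[of g _ x UNIV S f] assms
  by (auto simp: differentiable_def)

lemma Ck_on_cong:
  assumes "open S" "\<And>x. x \<in> S \<Longrightarrow> f x = g x"
  shows "Ck_on k S f \<longleftrightarrow> Ck_on k S g"
  using assms(2)
proof (induction k arbitrary: f g)
  case 0
  then show ?case using continuous_on_cong[OF refl, of S f g] by simp
next
  case (Suc k)
  have "Ck_on k S (\<lambda>x. frechet_derivative f (at x) v) = Ck_on k S (\<lambda>x. frechet_derivative g (at x) v)" for v
    by (intro Suc.IH) (simp add: frechet_derivative_cong_open[OF assms(1) _ Suc.prems])
  then show ?case
    using differentiable_cong_open[OF assms(1) _ Suc.prems] by simp
qed

lemma Ck_on_SucI:
  assumes "open S" "\<And>x. x \<in> S \<Longrightarrow> (f has_derivative f' x) (at x)" "\<And>v. Ck_on k S (\<lambda>x. f' x v)"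
  shows "Ck_on (Suc k) S f"
proof -
  have "Ck_on k S (\<lambda>x. frechet_derivative f (at x) v) = Ck_on k S (\<lambda>x. f' x v)" for v
    by (intro Ck_on_cong assms(1)) (simp add: frechet_derivative_eq[OF assms(2)])
  then show ?thesis using assms by (auto simp: differentiable_def)
qed

lemma Ck_on_SucD: "Ck_on (Suc k) S f \<Longrightarrow> Ck_on k S f"
proof (induction k arbitrary: f)
  case 0
  then show ?case
    by (auto intro: differentiable_imp_continuous_on simp: differentiable_on_def differentiable_at_withinI)
next
  case (Suc k)
  show ?case
    unfolding Ck_on.simps(2)[of k]
    using Suc.prems Suc.IH Ck_on.simps(2)[of "Suc k" S f] by blast
qed

lemma Ck_on_has_derivative:
  "Ck_on (Suc k) S f \<Longrightarrow> x \<in> S \<Longrightarrow> (f has_derivative frechet_derivative f (at x)) (at x)"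
  by (simp add: frechet_derivative_works)

lemma Ck_on_const: "open S \<Longrightarrow> Ck_on k S (\<lambda>x. c)"
proof (induction k arbitrary: c)
  case (Suc k)
  then show ?case by (intro Ck_on_SucI[where f' = "\<lambda>_ _. 0"]) auto
qed simp

lemma Ck_on_linear:
  assumes "open S" "bounded_linear T"
  shows "Ck_on k S T"
proof (cases k)
  case 0
  then show ?thesis using assms by (simp add: linear_continuous_on)
next
  case (Suc m)
  show ?thesis unfolding Suc
    by (rule Ck_on_SucI[where f' = "\<lambda>_. T"])
       (use assms in \<open>simp_all add: Ck_on_const bounded_linear_imp_has_derivative\<close>)
qed

lemma Ck_on_compose_linear:
  assumes "open S" "bounded_linear T" "Ck_on k S f"
  shows "Ck_on k S (\<lambda>x. T (f x))"
  using assms(3)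
proof (induction k arbitrary: f)
  case 0
  then show ?case using assms by (simp add: bounded_linear.continuous_on)
next
  case (Suc k)
  show ?case
    by (rule Ck_on_SucI[where f' = "\<lambda>x v. T (frechet_derivative f (at x) v)", OF assms(1)])
       (use Suc in \<open>simp_all add: bounded_linear.has_derivative[OF assms(2)] Ck_on_has_derivative\<close>)
qed

lemma Ck_on_add:
  assumes "open S" "Ck_on k S f" "Ck_on k S g"
  shows "Ck_on k S (\<lambda>x. f x + g x)"
  using assms(2,3)
proof (induction k arbitrary: f g)
  case 0
  then show ?case by (simp add: continuous_on_add)
next
  case (Suc k)
  show ?case
    by (rule Ck_on_SucI[where
          f' = "\<lambda>x v. frechet_derivative f (at x) v + frechet_derivative g (at x) v", OF assms(1)])
       (use Suc in \<open>simp_all add: has_derivative_add Ck_on_has_derivative\<close>)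
qed

text \<open>The Leibniz rule for a general bounded bilinear map serves products, scalar multiples
  and the Lorentz form at once.\<close>

lemma Ck_on_bilinear:
  assumes "open S" "bounded_bilinear p" "Ck_on k S f" "Ck_on k S g"
  shows "Ck_on k S (\<lambda>x. p (f x) (g x))"
  using assms(3,4)
proof (induction k arbitrary: f g)
  case 0
  then show ?case using bounded_bilinear.continuous_on[OF assms(2)] by simp
next
  case (Suc k)
  have "Ck_on k S f" "Ck_on k S g" using Suc.prems Ck_on_SucD by blast+
  then show ?case
    using Suc.prems
    by (intro Ck_on_SucI[where f' = "\<lambda>x v. p (f x) (frechet_derivative g (at x) v)
            + p (frechet_derivative f (at x) v) (g x)", OF assms(1)])
       (simp_all add: bounded_bilinear.FDERIV[OF assms(2)] Ck_on_has_derivative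
          Ck_on_add[OF assms(1)] Suc.IH)
qed

lemma frechet_derivative_real:
  fixes f :: "real \<Rightarrow> real"
  assumes "f differentiable (at x)"
  shows "frechet_derivative f (at x) v = v * deriv f x"
  using assms frechet_derivative_eq[of f "(*) (deriv f x)" x]
  by (simp add: DERIV_deriv_iff_real_differentiable[symmetric] has_field_derivative_def mult.commute)

lemma Ck_on_deriv:
  fixes f :: "real \<Rightarrow> real"
  assumes "open S" "Ck_on (Suc k) S f"
  shows "Ck_on k S (deriv f)"
proof -
  have "Ck_on k S (\<lambda>x. frechet_derivative f (at x) 1)" using assms(2) by simp
  moreover have "Ck_on k S (\<lambda>x. frechet_derivative f (at x) 1) = Ck_on k S (deriv f)"
    by (rule Ck_on_cong[OF assms(1)]) (use assms in \<open>simp add: frechet_derivative_real\<close>)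
  ultimately show ?thesis by simp
qed

text \<open>The outer function is real, so its derivative is again a real function,
  \<open>deriv g\<close>, to which the induction hypothesis applies.\<close>

lemma Ck_on_compose:
  fixes g :: "real \<Rightarrow> real"
  assumes "open S" "open T" "Ck_on k T g" "Ck_on k S f" "f ` S \<subseteq> T"
  shows "Ck_on k S (\<lambda>x. g (f x))"
  using assms(3,4)
proof (induction k arbitrary: g)
  case 0
  then show ?case using continuous_on_compose2[of T g S f] assms(5) by simp
next
  case (Suc k)
  have 1: "((\<lambda>x. g (f x)) has_derivative (\<lambda>v. deriv g (f x) * frechet_derivative f (at x) v)) (at x)"
    if "x \<in> S" for x
  proof -
    have "(g has_real_derivative deriv g (f x)) (at (f x))"
      using Suc.prems(1) that assms(5) by (auto simp: DERIV_deriv_iff_real_differentiable)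
    from has_derivative_compose[OF Ck_on_has_derivative[OF Suc.prems(2) that]
        this[unfolded has_field_derivative_def]]
    show ?thesis .
  qed
  have "Ck_on k S (\<lambda>x. deriv g (f x))"
    by (rule Suc.IH[OF Ck_on_deriv[OF assms(2) Suc.prems(1)] Ck_on_SucD[OF Suc.prems(2)]])
  then have "Ck_on k S (\<lambda>x. deriv g (f x) * frechet_derivative f (at x) v)" for v
    using Suc.prems(2) by (simp add: Ck_on_bilinear[OF assms(1) bounded_bilinear_mult])
  with 1 show ?case by (rule Ck_on_SucI[OF assms(1)])
qed

lemma smooth_onI: "(\<And>k. Ck_on k S f) \<Longrightarrow> smooth_on S f"
  by (simp add: smooth_on_def)

lemma smooth_onD: "smooth_on S f \<Longrightarrow> Ck_on k S f"
  by (simp add: smooth_on_def)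

lemma smooth_on_subset: "smooth_on S f \<Longrightarrow> T \<subseteq> S \<Longrightarrow> smooth_on T f"
proof -
  have "Ck_on k T f" if "Ck_on k S f" "T \<subseteq> S" for k using that
    by (induction k arbitrary: f) (auto intro: continuous_on_subset)
  then show "smooth_on S f \<Longrightarrow> T \<subseteq> S \<Longrightarrow> smooth_on T f"
    by (auto simp: smooth_on_def)
qed

lemma smooth_on_const: "open S \<Longrightarrow> smooth_on S (\<lambda>x. c)"
  by (simp add: smooth_on_def Ck_on_const)

lemma smooth_on_linear: "open S \<Longrightarrow> bounded_linear T \<Longrightarrow> smooth_on S T"
  by (simp add: smooth_on_def Ck_on_linear)

lemma smooth_on_compose_linear:
  "open S \<Longrightarrow> bounded_linear T \<Longrightarrow> smooth_on S f \<Longrightarrow> smooth_on S (\<lambda>x. T (f x))"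
  by (simp add: smooth_on_def Ck_on_compose_linear)

lemma smooth_on_add:
  "open S \<Longrightarrow> smooth_on S f \<Longrightarrow> smooth_on S g \<Longrightarrow> smooth_on S (\<lambda>x. f x + g x)"
  by (simp add: smooth_on_def Ck_on_add)

lemma smooth_on_bilinear:
  "open S \<Longrightarrow> bounded_bilinear p \<Longrightarrow> smooth_on S f \<Longrightarrow> smooth_on S g
    \<Longrightarrow> smooth_on S (\<lambda>x. p (f x) (g x))"
  by (simp add: smooth_on_def Ck_on_bilinear)

lemma smooth_on_compose:
  fixes g :: "real \<Rightarrow> real"
  shows "open S \<Longrightarrow> open T \<Longrightarrow> smooth_on T g \<Longrightarrow> smooth_on S f \<Longrightarrow> f ` S \<subseteq> T
    \<Longrightarrow> smooth_on S (\<lambda>x. g (f x))"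
  unfolding smooth_on_def using Ck_on_compose by blast

lemma smooth_on_Pair:
  fixes f :: "'a::euclidean_space \<Rightarrow> 'b::real_normed_vector" and g :: "'a \<Rightarrow> 'c::real_normed_vector"
  assumes "open S" "smooth_on S f" "smooth_on S g"
  shows "smooth_on S (\<lambda>x. (f x, g x))"
proof -
  have 1: "bounded_linear (\<lambda>x::'b. (x, 0::'c))" and 2: "bounded_linear (\<lambda>x::'c. (0::'b, x))"
    by (intro bounded_linear_Pair bounded_linear_ident bounded_linear_zero)+
  show ?thesis
    using smooth_on_add[OF assms(1) smooth_on_compose_linear[OF assms(1) 1 assms(2)]
        smooth_on_compose_linear[OF assms(1) 2 assms(3)]] by simp
qed

lemma smooth_on_deriv:
  fixes f :: "real \<Rightarrow> real"
  shows "open S \<Longrightarrow> smooth_on S f \<Longrightarrow> smooth_on S (deriv f)"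
  by (meson Ck_on_deriv smooth_on_def)

lemma smooth_on_has_real_derivative:
  fixes f :: "real \<Rightarrow> real"
  assumes "smooth_on S f" "x \<in> S"
  shows "(f has_real_derivative deriv f x) (at x)"
  using smooth_onD[OF assms(1), of 1] assms(2) by (simp add: DERIV_deriv_iff_real_differentiable)

text \<open>The exponent is general because differentiation lowers it. The chart uses the exponents
  -1 and -1/2.\<close>

lemma smooth_on_powr: "smooth_on {0<..} (\<lambda>x::real. x powr c)"
proof (rule smooth_onI)
  fix k show "Ck_on k {0<..} (\<lambda>x::real. x powr c)"
  proof (induction k arbitrary: c)
    case 0
    then show ?case by (auto intro!: continuous_intros)
  next
    case (Suc k)
    show ?case
    proof (rule Ck_on_SucI[where f' = "\<lambda>x v. v * (c * x powr (c - 1))"])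
      show "((\<lambda>x. x powr c) has_derivative (\<lambda>v. v * (c * x powr (c - 1)))) (at x)"
        if "x \<in> {0<..}" for x :: real
        using has_real_derivative_powr[of x c] that
        by (simp add: has_field_derivative_def mult.commute[of _ "_ * _"])
      show "Ck_on k {0<..} (\<lambda>x::real. v * (c * x powr (c - 1)))" for v
        by (intro Ck_on_bilinear[OF _ bounded_bilinear_mult] Ck_on_const Suc.IH) simp_all
    qed simp
  qed
qed

lemma smooth_on_inverse: "smooth_on {0<..} (inverse :: real \<Rightarrow> real)"
proof -
  have "Ck_on k {0<..} (\<lambda>x::real. x powr (- 1)) = Ck_on k {0<..} (inverse :: real \<Rightarrow> real)" for k
    by (rule Ck_on_cong) (auto simp: powr_minus)
  then show ?thesis using smooth_on_powr[of "- 1"] by (simp add: smooth_on_def)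
qed

lemma smooth_on_minus:
  "open S \<Longrightarrow> smooth_on S f \<Longrightarrow> smooth_on S (\<lambda>x. - f x)"
  using smooth_on_compose_linear[of S uminus f] bounded_linear_minus[OF bounded_linear_ident] by simp

lemmas smooth_on_mult = smooth_on_bilinear[OF _ bounded_bilinear_mult]

lemma smooth_on_ident: "open S \<Longrightarrow> smooth_on S (\<lambda>x. x)"
  by (rule smooth_on_linear[OF _ bounded_linear_ident])

section \<open>Curvature of radial metrics\<close>

lemma levi_civita_cong:
  assumes "open S" "x \<in> S" "\<And>y u v. y \<in> S \<Longrightarrow> G y u v = H y u v"
  shows "levi_civita G x u v = levi_civita H x u v"
proof -
  have "frechet_derivative (\<lambda>x. G x a b) (at x) = frechet_derivative (\<lambda>x. H x a b) (at x)" for a b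
    by (rule frechet_derivative_cong_open[OF assms(1,2)]) (rule assms(3))
  then show ?thesis by (simp add: levi_civita_def assms(2,3))
qed

text \<open>Curvature is local. This lets the pulled-back metric be replaced by an explicit one with
  which it agrees only on the domain of the chart.\<close>

lemma sectional_curvature_cong:
  assumes "open S" "x \<in> S" "\<And>y u v. y \<in> S \<Longrightarrow> G y u v = H y u v"
  shows "sectional_curvature G x u v = sectional_curvature H x u v"
proof -
  have L: "levi_civita G y a b = levi_civita H y a b" if "y \<in> S" for y a b
    by (rule levi_civita_cong[OF assms(1) that assms(3)])
  have "frechet_derivative (\<lambda>x. levi_civita G x a b) (at x) = frechet_derivative (\<lambda>x. levi_civita H x a b) (at x)" for a b
    by (rule frechet_derivative_cong_open[OF assms(1,2)]) (rule L)
  then show ?thesis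
    by (simp add: sectional_curvature_def riemann_curvature_def L[OF assms(2)] assms(3)[OF assms(2)])
qed

section \<open>The Lorentz form on C^n and multiplication by i\<close>

definition lorentz_form :: "'n::finite \<Rightarrow> complex ^ 'n \<Rightarrow> complex ^ 'n \<Rightarrow> real" where
  "lorentz_form \<nu> a b = lorentz_product \<nu> (a, 0) (b, 0)"

lemma lorentz_product_Pair: "lorentz_product \<nu> (a, x) (b, y) = lorentz_form \<nu> a b + x * y"
  by (simp add: lorentz_form_def lorentz_product_def)

text \<open>Bilinearity and symmetry are inherited from the Euclidean inner product through this
  form.\<close>

lemma lorentz_form_inner: "lorentz_form \<nu> a b = a \<bullet> b - 2 * (a $ \<nu> \<bullet> b $ \<nu>)"
proof -
  have "a \<bullet> b = (\<Sum>i\<in>UNIV - {\<nu>}. a $ i \<bullet> b $ i) + a $ \<nu> \<bullet> b $ \<nu>"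
    by (simp add: inner_vec_def sum.remove[of UNIV \<nu>])
  then show ?thesis
    by (simp add: lorentz_form_def lorentz_product_def inner_complex_def)
qed

lemma bounded_bilinear_lorentz_form: "bounded_bilinear (lorentz_form \<nu>)"
  unfolding bilinear_conv_bounded_bilinear[symmetric] bilinear_def
  by (auto intro!: linearI simp: lorentz_form_inner inner_simps algebra_simps)

lemmas lorentz_form_linear [simp] =
  bounded_bilinear.add_left[OF bounded_bilinear_lorentz_form]
  bounded_bilinear.add_right[OF bounded_bilinear_lorentz_form]
  bounded_bilinear.diff_left[OF bounded_bilinear_lorentz_form]
  bounded_bilinear.diff_right[OF bounded_bilinear_lorentz_form]
  bounded_bilinear.minus_left[OF bounded_bilinear_lorentz_form]
  bounded_bilinear.minus_right[OF bounded_bilinear_lorentz_form]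
  bounded_bilinear.scaleR_left[OF bounded_bilinear_lorentz_form]
  bounded_bilinear.scaleR_right[OF bounded_bilinear_lorentz_form]
  bounded_bilinear.zero_left[OF bounded_bilinear_lorentz_form]
  bounded_bilinear.zero_right[OF bounded_bilinear_lorentz_form]

lemma lorentz_form_commute: "lorentz_form \<nu> a b = lorentz_form \<nu> b a"
  by (simp add: lorentz_form_inner inner_commute)

lemma ii_linear [simp]:
  fixes a b :: "complex ^ 'n::finite"
  shows "\<i> *s (a + b) = \<i> *s a + \<i> *s b" "\<i> *s (a - b) = \<i> *s a - \<i> *s b" "\<i> *s (- a) = - (\<i> *s a)"
    "\<i> *s (r *\<^sub>R a) = r *\<^sub>R (\<i> *s a)" "\<i> *s (\<i> *s a) = - a"
  by (simp_all add: vec_eq_iff algebra_simps)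

lemma bounded_linear_ii: "bounded_linear (\<lambda>a :: complex ^ 'n::finite. \<i> *s a)"
  by (auto intro!: linearI simp: linear_conv_bounded_linear[symmetric])

text \<open>As a rewrite rule it moves every i to the left argument, which gives the simplifier a
  normal form.\<close>

lemma lorentz_form_ii_skew [simp]: "lorentz_form \<nu> a (\<i> *s b) = - lorentz_form \<nu> (\<i> *s a) b"
proof -
  have "x \<bullet> (\<i> * y) = - ((\<i> * x) \<bullet> y)" for x y :: complex
    by (simp add: inner_complex_def)
  then show ?thesis by (simp add: lorentz_form_inner inner_vec_def sum_negf)
qed

lemma lorentz_form_ii_self [simp]: "lorentz_form \<nu> (\<i> *s a) a = 0"
  using lorentz_form_ii_skew[of \<nu> a a] lorentz_form_commute[of \<nu> a "\<i> *s a"] by simp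

lemma lorentz_form_nondegenerate:
  assumes "\<And>b. lorentz_form \<nu> a b = 0"
  shows "a = 0"
proof -
  \<comment> \<open>Changing the sign of the component at \<open>\<nu>\<close> turns the Lorentz
    form into the Euclidean inner product.\<close>
  have "lorentz_form \<nu> a (\<chi> i. if i = \<nu> then - a $ i else a $ i) = a \<bullet> a"
  proof -
    have "(\<Sum>i\<in>UNIV - {\<nu>}. a $ i \<bullet> (if i = \<nu> then - a $ i else a $ i)) = (\<Sum>i\<in>UNIV - {\<nu>}. a $ i \<bullet> a $ i)"
      by (rule sum.cong) auto
    then show ?thesis
      by (simp add: lorentz_form_inner inner_vec_def sum.remove[of UNIV \<nu>])
  qed
  then show ?thesis using assms by simp
qed

definition timelike_square :: "'n::finite \<Rightarrow> complex ^ 'n \<Rightarrow> real" where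
  "timelike_square \<nu> z = - lorentz_form \<nu> z z"

lemma timelike_square_has_derivative: "(timelike_square \<nu> has_derivative (\<lambda>w. - 2 * lorentz_form \<nu> z w)) (at z)"
  unfolding timelike_square_def
  by (auto intro!: derivative_eq_intros bounded_bilinear.FDERIV[OF bounded_bilinear_lorentz_form]
      simp: lorentz_form_commute[of \<nu> _ z])

lemma continuous_on_timelike_square: "continuous_on S (timelike_square \<nu>)"
  by (intro continuous_at_imp_continuous_on ballI has_derivative_continuous[OF timelike_square_has_derivative])

text \<open>
  Metrics \<open>A h + B h(z, \<cdot>)\<^sup>2 + C h(iz, \<cdot>)\<^sup>2\<close> with coefficients depending on \<open>-h(z, z)\<close>. The last two
  assumptions express nondegeneracy in the directions \<open>z\<close> and \<open>iz\<close>.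
\<close>

locale radial_metric =
  fixes \<nu> :: "'n::finite" and A B C A' B' C' :: "real \<Rightarrow> real" and R :: "real set"
  assumes open_R: "open R"
    and deriv_A: "\<And>r. r \<in> R \<Longrightarrow> (A has_real_derivative A' r) (at r)"
    and deriv_B: "\<And>r. r \<in> R \<Longrightarrow> (B has_real_derivative B' r) (at r)"
    and deriv_C: "\<And>r. r \<in> R \<Longrightarrow> (C has_real_derivative C' r) (at r)"
    and diff_A': "\<And>r. r \<in> R \<Longrightarrow> A' differentiable (at r)"
    and diff_B': "\<And>r. r \<in> R \<Longrightarrow> B' differentiable (at r)"
    and diff_C': "\<And>r. r \<in> R \<Longrightarrow> C' differentiable (at r)"
    and A_nonzero: "\<And>r. r \<in> R \<Longrightarrow> A r \<noteq> 0"
    and radial_nonzero: "\<And>r. r \<in> R \<Longrightarrow> A r - r * B r \<noteq> 0"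
    and fibre_nonzero: "\<And>r. r \<in> R \<Longrightarrow> A r - r * C r \<noteq> 0"
begin

abbreviation h :: "complex ^ 'n \<Rightarrow> complex ^ 'n \<Rightarrow> real" where "h \<equiv> lorentz_form \<nu>"

abbreviation rho :: "complex ^ 'n \<Rightarrow> real" where "rho \<equiv> timelike_square \<nu>"

definition G :: "complex ^ 'n \<Rightarrow> complex ^ 'n \<Rightarrow> complex ^ 'n \<Rightarrow> real" where
  "G z u v = A (rho z) * h u v + B (rho z) * (h z u * h z v)
     + C (rho z) * (h (\<i> *s z) u * h (\<i> *s z) v)"

definition dG :: "complex ^ 'n \<Rightarrow> complex ^ 'n \<Rightarrow> complex ^ 'n \<Rightarrow> complex ^ 'n \<Rightarrow> real" where
  "dG z w a b =
     - 2 * h z w * (A' (rho z) * h a b + B' (rho z) * (h z a * h z b)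
        + C' (rho z) * (h (\<i> *s z) a * h (\<i> *s z) b))
     + B (rho z) * (h w a * h z b + h z a * h w b)
     + C (rho z) * (h (\<i> *s w) a * h (\<i> *s z) b + h (\<i> *s z) a * h (\<i> *s w) b)"

lemma G_has_derivative:
  assumes "rho z \<in> R"
  shows "((\<lambda>z. G z a b) has_derivative (\<lambda>w. dG z w a b)) (at z)"
proof -
  have P: "((\<lambda>z. h z c) has_derivative (\<lambda>w. h w c)) (at z)" for c
    by (rule bounded_linear_imp_has_derivative[OF
          bounded_bilinear.bounded_linear_left[OF bounded_bilinear_lorentz_form]])
  have Q: "((\<lambda>z. h (\<i> *s z) c) has_derivative (\<lambda>w. h (\<i> *s w) c)) (at z)" for c
    by (rule bounded_linear_imp_has_derivative[OF
          bounded_linear_compose[OF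
            bounded_bilinear.bounded_linear_left[OF bounded_bilinear_lorentz_form] bounded_linear_ii]])
  have "((\<lambda>z. A (rho z)) has_derivative (\<lambda>w. - 2 * h z w * A' (rho z))) (at z)"
    "((\<lambda>z. B (rho z)) has_derivative (\<lambda>w. - 2 * h z w * B' (rho z))) (at z)"
    "((\<lambda>z. C (rho z)) has_derivative (\<lambda>w. - 2 * h z w * C' (rho z))) (at z)"
    using DERIV_compose_FDERIV[OF _ timelike_square_has_derivative] deriv_A deriv_B deriv_C assms by blast+
  note d = this P Q
  show ?thesis
    unfolding G_def dG_def
    by (rule derivative_eq_intros d refl ext | simp add: algebra_simps)+
qed

text \<open>
  \<open>W z a b\<close> represents half the right-hand side of the Koszul formula with respect to \<open>h\<close>; \<open>sharp z\<close>
  turns \<open>h\<close>-representatives into \<open>G z\<close>-representatives.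
\<close>

definition W :: "complex ^ 'n \<Rightarrow> complex ^ 'n \<Rightarrow> complex ^ 'n \<Rightarrow> complex ^ 'n" where
  "W z a b =
     (h a b * (A' (rho z) + B (rho z)) - B' (rho z) * (h z a * h z b)
        + C' (rho z) * (h (\<i> *s z) a * h (\<i> *s z) b)) *\<^sub>R z
     - (C' (rho z) * (h z a * h (\<i> *s z) b + h z b * h (\<i> *s z) a)) *\<^sub>R (\<i> *s z)
     - (A' (rho z) * h z a) *\<^sub>R b - (A' (rho z) * h z b) *\<^sub>R a
     + (C (rho z) * h (\<i> *s z) b) *\<^sub>R (\<i> *s a) + (C (rho z) * h (\<i> *s z) a) *\<^sub>R (\<i> *s b)"

definition sharp :: "complex ^ 'n \<Rightarrow> complex ^ 'n \<Rightarrow> complex ^ 'n" where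
  "sharp z w = inverse (A (rho z)) *\<^sub>R
     (w - (B (rho z) * h z w * inverse (A (rho z) - rho z * B (rho z))) *\<^sub>R z
        - (C (rho z) * h (\<i> *s z) w * inverse (A (rho z) - rho z * C (rho z))) *\<^sub>R (\<i> *s z))"

lemma h_W: "2 * h (W z a b) y = dG z a b y + dG z b a y - dG z y a b"
proof -
  \<comment> \<open>With i on the left, h(ic, d) is antisymmetric in c and d; the instances below
    orient each such pair the same way.\<close>
  have "h (\<i> *s c) d = - h (\<i> *s d) c" for c d
    using lorentz_form_commute[of \<nu> "\<i> *s c" d] by simp
  then have skew: "h (\<i> *s b) a = - h (\<i> *s a) b" "h (\<i> *s y) a = - h (\<i> *s a) y"
     "h (\<i> *s y) b = - h (\<i> *s b) y"
    by blast+
  have comm: "h b a = h a b" "h y a = h a y" "h y b = h b y"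
    by (rule lorentz_form_commute)+
  show ?thesis
    unfolding W_def dG_def skew by (simp add: comm algebra_simps)
qed

text \<open>Inversion of a rank-one perturbation, twice: z and iz are \<open>h\<close>-orthogonal,
  so the two corrections do not interact, and the pairings of \<open>sharp z w\<close> with z and
  with iz are found separately.\<close>

lemma G_sharp:
  assumes "rho z \<in> R"
  shows "G z (sharp z w) y = h w y"
proof -
  let ?A = "A (rho z)" let ?B = "B (rho z)" let ?C = "C (rho z)" let ?r = "rho z"
  have n: "?A \<noteq> 0" "?A - ?r * ?B \<noteq> 0" "?A - ?r * ?C \<noteq> 0"
    using A_nonzero radial_nonzero fibre_nonzero assms by auto
  have hz: "h z z = - ?r" "h (\<i> *s z) (\<i> *s z) = - ?r" by (simp_all add: timelike_square_def)
  have 0: "h z (\<i> *s z) = 0" by simp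
  have P: "h z (sharp z w) = h z w / (?A - ?r * ?B)"
    unfolding sharp_def lorentz_form_linear hz 0 using n by (simp add: field_simps)
  have Q: "h (\<i> *s z) (sharp z w) = h (\<i> *s z) w / (?A - ?r * ?C)"
    unfolding sharp_def lorentz_form_linear hz lorentz_form_ii_self using n by (simp add: field_simps)
  have "?A * h (sharp z w) y = h w y - ?B * h z w / (?A - ?r * ?B) * h z y
      - ?C * h (\<i> *s z) w / (?A - ?r * ?C) * h (\<i> *s z) y"
    unfolding sharp_def using n(1) by (simp add: divide_inverse)
  then show ?thesis unfolding G_def P Q by (simp add: algebra_simps)
qed

lemma G_commute: "G z u v = G z v u"
  unfolding G_def by (simp add: lorentz_form_commute[of \<nu> u v] algebra_simps)

text \<open>Pairing w with the vectors \<open>sharp z y\<close> recovers all values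
  \<open>h y w\<close>, so nondegeneracy passes from \<open>h\<close> to G.\<close>

lemma G_nondegenerate:
  assumes "rho z \<in> R" "\<And>y. G z w y = 0"
  shows "w = 0"
proof -
  have "G z w (sharp z y) = h y w" for y
    using G_sharp[OF assms(1), of y w] G_commute by simp
  then have "h w y = 0" for y using assms(2) lorentz_form_commute[of \<nu> y w] by simp
  then show ?thesis by (rule lorentz_form_nondegenerate)
qed

text \<open>\<open>levi_civita\<close> is a definite description: solving the Koszul equation is
  half of the work, and uniqueness comes from nondegeneracy of G.\<close>

lemma levi_civita_eq:
  assumes "rho z \<in> R"
  shows "levi_civita G z a b = sharp z (W z a b)"
proof -
  have F: "frechet_derivative (\<lambda>z. G z c d) (at z) = (\<lambda>w. dG z w c d)" for c d
    by (rule frechet_derivative_eq[OF G_has_derivative[OF assms]])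
  show ?thesis unfolding levi_civita_def F
  proof (rule the_equality)
    show "\<forall>y. 2 * G z (sharp z (W z a b)) y = dG z a b y + dG z b a y - dG z y a b"
      by (simp add: G_sharp[OF assms] h_W)
    fix w assume w: "\<forall>y. 2 * G z w y = dG z a b y + dG z b a y - dG z y a b"
    have "G z (w - sharp z (W z a b)) y = 0" for y
      using w[rule_format, of y] h_W[of z a b y] G_sharp[OF assms, of "W z a b" y]
      by (simp add: G_def algebra_simps)
    from G_nondegenerate[OF assms this] show "w = sharp z (W z a b)" by simp
  qed
qed

section \<open>Derivatives of the connection and the curvature of a horizontal plane\<close>

lemma differentiable_compose_rho:
  assumes "f differentiable (at (rho z))"
  shows "(\<lambda>z. f (rho z)) differentiable (at z)"
proof -
  obtain D where "(f has_derivative D) (at (rho z))" using assms by (auto simp: differentiable_def)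
  from has_derivative_compose[OF timelike_square_has_derivative this] show ?thesis
    by (rule differentiableI)
qed

text \<open>The curvature applies \<open>frechet_derivative\<close> to the connection, which is
  meaningful only where the connection is differentiable; hence the differentiability of A', B', C'
  in the locale.\<close>

lemma sharp_W_differentiable:
  assumes "rho z \<in> R"
  shows "(\<lambda>z. sharp z (W z a b)) differentiable (at z)"
proof -
  have hh: "(\<lambda>z. h (f z) (g z)) differentiable (at z)"
    if "f differentiable (at z)" "g differentiable (at z)" for f g :: "complex ^ 'n \<Rightarrow> complex ^ 'n"
    using that bounded_bilinear.FDERIV[OF bounded_bilinear_lorentz_form]
    unfolding differentiable_def by blast
  have ii: "(\<lambda>z. \<i> *s z) differentiable (at z)"
    by (simp add: bounded_linear_ii bounded_linear_imp_differentiable)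
  have sc: "(\<lambda>z. f z *\<^sub>R g z) differentiable (at z)"
    if "f differentiable (at z)" "g differentiable (at z)"
    for f :: "complex ^ 'n \<Rightarrow> real" and g :: "complex ^ 'n \<Rightarrow> complex ^ 'n"
    using that by (rule differentiable_scaleR)
  have "A differentiable (at (rho z))" "B differentiable (at (rho z))" "C differentiable (at (rho z))"
    using deriv_A deriv_B deriv_C assms by (meson real_differentiable_def)+
  note c = this[THEN differentiable_compose_rho]
    diff_A'[OF assms, THEN differentiable_compose_rho]
    diff_B'[OF assms, THEN differentiable_compose_rho]
    diff_C'[OF assms, THEN differentiable_compose_rho]
  have r: "rho differentiable (at z)" using timelike_square_has_derivative differentiable_def by blast
  note intros = hh ii sc c r differentiable_add differentiable_diff differentiable_mult
    differentiable_const differentiable_ident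
  have W: "(\<lambda>z. W z a b) differentiable (at z)"
    unfolding W_def by (intro intros)
  show ?thesis unfolding sharp_def
    using A_nonzero radial_nonzero fibre_nonzero assms
    by (intro intros W differentiable_inverse) auto
qed

text \<open>Reduces the derivatives of the connection to derivatives of real functions of one real
  variable.\<close>

lemma frechet_derivative_form_line:
  assumes "f differentiable (at z)"
  shows "((\<lambda>x. h (f (z + x *\<^sub>R w)) c) has_real_derivative
     h (frechet_derivative f (at z) w) c) (at 0)"
proof -
  have f: "(f has_derivative frechet_derivative f (at z)) (at z)"
    using assms by (simp add: frechet_derivative_works)
  have "((\<lambda>x. z + x *\<^sub>R w) has_derivative (\<lambda>x. x *\<^sub>R w)) (at 0)"
    by (auto intro!: derivative_eq_intros)
  from has_derivative_compose[OF this, of f "frechet_derivative f (at z)"] f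
  have "((\<lambda>x. f (z + x *\<^sub>R w)) has_derivative (\<lambda>x. frechet_derivative f (at z) (x *\<^sub>R w))) (at 0)"
    by simp
  from bounded_linear.has_derivative[OF
      bounded_bilinear.bounded_linear_left[OF bounded_bilinear_lorentz_form] this]
  have "((\<lambda>x. h (f (z + x *\<^sub>R w)) c) has_derivative
      (\<lambda>x. h (frechet_derivative f (at z) (x *\<^sub>R w)) c)) (at 0)" .
  moreover have "frechet_derivative f (at z) (x *\<^sub>R w) = x *\<^sub>R frechet_derivative f (at z) w" for x
    by (rule linear_scale[OF has_derivative_linear[OF f]])
  ultimately show ?thesis by (simp add: has_field_derivative_def mult_commute_abs)
qed

text \<open>Caratheodory's criterion. Continuity of k at 0 suffices, so the coefficients collected
  in k are never differentiated.\<close>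

lemma has_real_derivative_times_ident:
  fixes k :: "real \<Rightarrow> real"
  assumes "isCont k 0"
  shows "((\<lambda>x. x * k x) has_real_derivative k 0) (at 0)"
  unfolding CARAT_DERIV using assms by (intro exI[of _ k]) (simp add: mult.commute)

text \<open>On the lines through z in the directions u and iu, \<open>rho\<close> is 1 - x^2 and
  hence stationary at x = 0, so B' and C' occur only with a factor x^2 and drop out. The quotient by
  A - B arises because the derivative of iu along itself is a radial vector c z.\<close>

lemma sectional_curvature_horizontal:
  assumes z: "rho z = 1" "1 \<in> R" and u: "h z u = 0" "h (\<i> *s z) u = 0" "h u u = 1"
  shows "sectional_curvature G z u (\<i> *s u) =
    (2 * A' 1 + B 1 - 3 * C 1 + (A' 1 + B 1)\<^sup>2 / (A 1 - B 1)) / (A 1)\<^sup>2"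
proof -
  define v where "v = \<i> *s u"
  have hzz: "h z z = - 1" using z by (simp add: timelike_square_def)
  have hz': "h u z = 0" "h (\<i> *s u) z = 0"
    using u lorentz_form_commute[of \<nu> u z] lorentz_form_commute[of \<nu> "\<i> *s u" z] by simp_all
  note v = v_def u hz' hzz
  have zR: "rho z \<in> R" using z by simp
  have nz: "A 1 \<noteq> 0" "A 1 - B 1 \<noteq> 0" "A 1 - C 1 \<noteq> 0"
    using A_nonzero[OF z(2)] radial_nonzero[OF z(2)] fibre_nonzero[OF z(2)] by auto
  have isCont: "isCont A 1" "isCont B 1" "isCont C 1" "isCont A' 1" "isCont B' 1" "isCont C' 1"
    using deriv_A[OF z(2)] deriv_B[OF z(2)] deriv_C[OF z(2)]
      diff_A'[OF z(2)] diff_B'[OF z(2)] diff_C'[OF z(2)]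
    by (auto dest: DERIV_isCont simp: differentiable_imp_continuous_within)
  have cont: "isCont (\<lambda>x. f (1 - x * x)) 0" if "isCont f 1" for f :: "real \<Rightarrow> real"
    by (rule isCont_o2[where g = f]) (use that in \<open>auto intro!: continuous_intros\<close>)
  note cont = isCont[THEN cont]
  have open_U: "open {z. rho z \<in> R}"
    using continuous_open_preimage[OF continuous_on_timelike_square open_UNIV open_R]
    by (simp add: vimage_def)

  \<comment> \<open>The explicit formula for the connection holds on an open set around z, so it may
    be differentiated there.\<close>
  have FD: "frechet_derivative (\<lambda>z. levi_civita G z a b) (at z)
      = frechet_derivative (\<lambda>z. sharp z (W z a b)) (at z)" for a b
    by (rule frechet_derivative_cong_open[OF open_U]) (use zR levi_civita_eq in auto)
  have line: "((\<lambda>x. h (sharp (z + x *\<^sub>R w) (W (z + x *\<^sub>R w) a b)) u) has_real_derivative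
     h (frechet_derivative (\<lambda>z. levi_civita G z a b) (at z) w) u) (at 0)" for a b w
    unfolding FD by (rule frechet_derivative_form_line[OF sharp_W_differentiable[OF zR]])

  \<comment> \<open>Along the lines $z + xu$ and $z + xv$ the Christoffel terms that enter the curvature are of the form
    $x\,k(x)$ with $k$ continuous, so only the value $k(0)$ matters for their derivatives.\<close>
  define k1 where "k1 x = inverse (A (1 - x * x)) *
     ((A' (1 - x * x) + B (1 - x * x) + C' (1 - x * x) * (x * x)) - 2 * C (1 - x * x)
      + B (1 - x * x) * ((A' (1 - x * x) + B (1 - x * x) + C' (1 - x * x) * (x * x)) * (1 - x * x)
          + 2 * C (1 - x * x) * (x * x))
        * inverse (A (1 - x * x) - (1 - x * x) * B (1 - x * x)))" for x
  have k1: "h (sharp (z + x *\<^sub>R u) (W (z + x *\<^sub>R u) v v)) u = x * k1 x" for x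
  proof -
    let ?z = "z + x *\<^sub>R u"
    have r: "rho ?z = 1 - x * x" by (simp add: timelike_square_def v)
    have c: "h ?z u = x" "h (\<i> *s ?z) u = 0" "h ?z v = 0" "h (\<i> *s ?z) v = x" "h v v = 1"
      "h ?z ?z = - (1 - x * x)" "\<i> *s v = - u"
      by (simp_all add: v)
    define m where "m = A' (1 - x * x) + B (1 - x * x) + C' (1 - x * x) * (x * x)"
    have W: "W ?z v v = m *\<^sub>R ?z - (C (1 - x * x) * x) *\<^sub>R u - (C (1 - x * x) * x) *\<^sub>R u"
      unfolding W_def r c m_def by simp
    have W1: "h (W ?z v v) u = m * x - 2 * C (1 - x * x) * x"
      "h ?z (W ?z v v) = - m * (1 - x * x) - 2 * C (1 - x * x) * x * x"
      unfolding W lorentz_form_linear(3,4,7,8) c u(3) by (simp_all add: algebra_simps)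
    show ?thesis
      unfolding sharp_def lorentz_form_linear(3,4,7,8) W1 r c k1_def m_def[symmetric]
      by (simp add: algebra_simps)
  qed
  have "isCont k1 0"
    unfolding k1_def using nz by (intro continuous_intros cont) auto
  from has_real_derivative_times_ident[OF this]
  have D1: "h (frechet_derivative (\<lambda>z. levi_civita G z v v) (at z) u) u = k1 0"
    using line[of u v v] unfolding k1 by (rule DERIV_unique[rotated])

  define k2 where "k2 y = inverse (A (1 - y * y)) *
     (C (1 - y * y) - A' (1 - y * y) - C' (1 - y * y) * (y * y)
      + C (1 - y * y) * (y * y * (A' (1 - y * y) - C (1 - y * y)) - C' (1 - y * y) * (y * y) * (1 - y * y))
        * inverse (A (1 - y * y) - (1 - y * y) * C (1 - y * y)))" for y
  have k2: "h (sharp (z + y *\<^sub>R v) (W (z + y *\<^sub>R v) u v)) u = y * k2 y" for y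
  proof -
    let ?z = "z + y *\<^sub>R v"
    have r: "rho ?z = 1 - y * y" by (simp add: timelike_square_def v)
    have c: "h ?z u = 0" "h (\<i> *s ?z) u = - y" "h ?z v = y" "h (\<i> *s ?z) v = 0" "h u v = 0"
      "h (\<i> *s ?z) (\<i> *s ?z) = - (1 - y * y)" "\<i> *s v = - u"
      by (simp_all add: v)
    have W: "W ?z u v = (C' (1 - y * y) * (y * y)) *\<^sub>R (\<i> *s ?z) + (y * (C (1 - y * y) - A' (1 - y * y))) *\<^sub>R u"
      unfolding W_def r c by (simp add: algebra_simps)
    have W1: "h (W ?z u v) u = - C' (1 - y * y) * (y * y) * y + y * (C (1 - y * y) - A' (1 - y * y))"
      "h (\<i> *s ?z) (W ?z u v) = - C' (1 - y * y) * (y * y) * (1 - y * y) - y * (C (1 - y * y) - A' (1 - y * y)) * y"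
      unfolding W lorentz_form_linear(1-4,7,8) c u(3) by (simp_all add: algebra_simps)
    show ?thesis
      unfolding sharp_def lorentz_form_linear(3,4,7,8) W1 r c k2_def
      by (simp add: algebra_simps)
  qed
  have "isCont k2 0"
    unfolding k2_def using nz by (intro continuous_intros cont) auto
  from has_real_derivative_times_ident[OF this]
  have D2: "h (frechet_derivative (\<lambda>z. levi_civita G z u v) (at z) v) u = k2 0"
    using line[of v u v] unfolding k2 by (rule DERIV_unique[rotated])

  have L: "levi_civita G z a b = sharp z (W z a b)" for a b
    by (rule levi_civita_eq[OF zR])
  \<comment> \<open>Each summand contains h(u, v) or a pairing of u or v with z or iz, and all of
    these vanish.\<close>
  have Wuv: "W z u v = 0" by (simp add: W_def v)
  have L2: "levi_civita G z u v = 0" unfolding L Wuv by (simp add: sharp_def)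
  have L3: "levi_civita G z v 0 = 0" unfolding L by (simp add: W_def sharp_def)
  \<comment> \<open>The Levi-Civita derivative of v along v is c z: since h(z, z) = -1,
    \<open>sharp z\<close> divides the radial vector z by A - B.\<close>
  define c where "c = (A' 1 + B 1) / (A 1 - B 1)"
  have Wvv: "W z v v = (A' 1 + B 1) *\<^sub>R z" by (simp add: W_def v z(1))
  have L1: "levi_civita G z v v = c *\<^sub>R z"
  proof -
    have "inverse (A 1) * (A' 1 + B 1 - B 1 * (- (A' 1 + B 1)) * inverse (A 1 - B 1)) = c"
      unfolding c_def using nz by (simp add: field_simps)
    then show ?thesis unfolding L Wvv sharp_def
      by (simp add: z(1) v scaleR_diff_left[symmetric] scaleR_add_left[symmetric])
  qed
  \<comment> \<open>The corrections in \<open>sharp\<close> point along z and iz, which are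
    orthogonal to u.\<close>
  have hsharp: "h (sharp z w) u = h w u / A 1" for w
    by (simp add: sharp_def z(1) u divide_inverse)
  have L4: "h (levi_civita G z u (c *\<^sub>R z)) u = A' 1 * c / A 1"
    unfolding L hsharp by (simp add: W_def v z(1))
  have GX: "G z X u = A 1 * h X u" for X
    by (simp add: G_def z(1) u)
  have "G z (riemann_curvature G z u v v) u = A 1 * (k1 0 + A' 1 * c / A 1 - k2 0)"
    unfolding GX riemann_curvature_def by (simp add: D1 D2 L1 L2 L3 L4)
  also have "\<dots> = 2 * A' 1 + B 1 - 3 * C 1 + (A' 1 + B 1) * c"
  proof -
    have k1: "k1 0 = ((A' 1 + B 1) - 2 * C 1 + B 1 * c) / A 1"
      unfolding k1_def c_def by (simp add: divide_inverse algebra_simps)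
    have k2: "k2 0 = (C 1 - A' 1) / A 1"
      unfolding k2_def by (simp add: divide_inverse algebra_simps)
    show ?thesis unfolding k1 k2 using nz by (simp add: field_simps)
  qed
  also have "(A' 1 + B 1) * c = (A' 1 + B 1)\<^sup>2 / (A 1 - B 1)"
    by (simp add: c_def power2_eq_square)
  finally have num: "G z (riemann_curvature G z u v v) u
    = 2 * A' 1 + B 1 - 3 * C 1 + (A' 1 + B 1)\<^sup>2 / (A 1 - B 1)" .
  have den: "G z u u * G z v v - (G z u v)\<^sup>2 = (A 1)\<^sup>2"
    by (simp add: G_def z(1) v power2_eq_square)
  show ?thesis
    unfolding sectional_curvature_def v_def[symmetric] num den ..
qed

end

section \<open>The chart of the hypersurface\<close>

text \<open>
  The chart takes $s = s_0 + \rho - 1$ with $\rho = -h'(z, z)$ as the parameter of the meridian, and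
  $z / \sqrt\rho$ as the point of the hyperboloid, so that no inverse function is needed; the point
  of interest has $\rho = 1$.
\<close>

locale type_III_chart =
  fixes \<nu> :: "'n::finite" and t q :: "real \<Rightarrow> real" and I :: "real set" and s0 :: real
  assumes type_III: "type_III \<nu> t q I" and s0: "s0 \<in> I"
begin

lemma open_I: "open I" and smooth_t: "smooth_on I t" and smooth_q: "smooth_on I q"
  and t_pos: "\<forall>s\<in>I. t s > 0"
  using type_III by (auto simp: type_III_def)

lemma natural_parameter: "s \<in> I \<Longrightarrow> (deriv q s)\<^sup>2 = (deriv t s)\<^sup>2 - 1"
  and deriv_t_le: "s \<in> I \<Longrightarrow> deriv t s \<le> - 1"
  using type_III by (auto simp: type_III_def)

lemmas has_deriv_t = smooth_on_has_real_derivative[OF smooth_t]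
lemmas has_deriv_q = smooth_on_has_real_derivative[OF smooth_q]

lemma t_decreasing:
  assumes "x \<in> I" "y \<in> I" "x < y"
  shows "t y < t x"
proof (rule DERIV_neg_imp_decreasing[OF assms(3)])
  fix s assume "x \<le> s" "s \<le> y"
  then have "s \<in> I" using type_III assms mem_is_interval_1_I unfolding type_III_def by metis
  then show "\<exists>d. (t has_real_derivative d) (at s) \<and> d < 0"
    using has_deriv_t deriv_t_le by force
qed

lemma inj_t: "inj_on t I"
  by (metis inj_onI linorder_neqE_linordered_idom order_less_irrefl t_decreasing)

definition arc :: "real \<Rightarrow> real" where "arc r = r + (s0 - 1)"

definition R :: "real set" where "R = {0<..} \<inter> arc -` I"

text \<open>A, B, C are the coefficients of the pulled-back Kaehler metric. In B, the -4 of the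
  induced metric meets 4 (1 - t') from the square of \<open>eta\<close>, which leaves -4 t'; C comes
  from \<open>eta_tilde\<close> alone. Only sums, products and \<open>inverse\<close> are used, so
  that the closure rules for smoothness match.\<close>

definition A :: "real \<Rightarrow> real" where "A r = t (arc r) * t (arc r) * inverse r"

definition B :: "real \<Rightarrow> real" where
  "B r = t (arc r) * t (arc r) * (inverse r * inverse r) + - 4 * deriv t (arc r)"

definition C :: "real \<Rightarrow> real" where
  "C r = t (arc r) * t (arc r) * (inverse r * inverse r) * (1 + - 1 * deriv t (arc r))"

definition U :: "(complex ^ 'n) set" where "U = timelike_square \<nu> -` R"

definition scale :: "real \<Rightarrow> real" where "scale r = t (arc r) * r powr (- 1 / 2)"

definition chart :: "complex ^ 'n \<Rightarrow> 'n ambient" where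
  "chart z = (scale (timelike_square \<nu> z) *\<^sub>R z, q (arc (timelike_square \<nu> z)))"

lemma open_R: "open R"
  unfolding R_def arc_def by (intro open_Int continuous_open_vimage open_I) (auto intro!: continuous_intros)

lemma open_U: "open U"
  unfolding U_def
  by (rule continuous_open_vimage[OF open_R])
     (simp add: has_derivative_continuous[OF timelike_square_has_derivative])

lemma one_in_R: "1 \<in> R" by (simp add: R_def arc_def s0)

lemma smooth_on_arc:
  fixes f :: "real \<Rightarrow> real"
  assumes "smooth_on I f"
  shows "smooth_on R (\<lambda>r. f (arc r))"
proof (rule smooth_on_compose[OF open_R open_I assms])
  show "smooth_on R arc"
    unfolding arc_def[abs_def]
    by (rule smooth_on_add[OF open_R smooth_on_ident smooth_on_const]) (rule open_R)+
qed (auto simp: R_def)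

lemma smooth_coefficients: "smooth_on R A" "smooth_on R B" "smooth_on R C"
  and smooth_scale: "smooth_on R scale"
proof -
  note t = smooth_on_arc[OF smooth_t] and t' = smooth_on_arc[OF smooth_on_deriv[OF open_I smooth_t]]
  have p: "{0<..} \<inter> arc -` I \<subseteq> {0<..}" by blast
  have i: "smooth_on R inverse" "smooth_on R (\<lambda>r. r powr (- 1 / 2))"
    unfolding R_def by (rule smooth_on_subset[OF smooth_on_inverse p] smooth_on_subset[OF smooth_on_powr p])+
  show "smooth_on R A" "smooth_on R B" "smooth_on R C" "smooth_on R scale"
    unfolding A_def B_def C_def scale_def
    by (intro smooth_on_mult smooth_on_add smooth_on_const t t' i open_R)+
qed

text \<open>Both nondegeneracy factors are positive multiples of t', which is negative in type III.
  In particular G(z, z) = -r (A - r B) is positive.\<close>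

sublocale radial_metric \<nu> A B C "deriv A" "deriv B" "deriv C" R
proof
  show "open R" by (rule open_R)
  fix r assume r: "r \<in> R"
  show "(A has_real_derivative deriv A r) (at r)" "(B has_real_derivative deriv B r) (at r)"
    "(C has_real_derivative deriv C r) (at r)"
    using smooth_coefficients r by (auto intro: smooth_on_has_real_derivative)
  show "deriv A differentiable at r" "deriv B differentiable at r" "deriv C differentiable at r"
    using smooth_on_has_real_derivative[OF smooth_on_deriv[OF open_R smooth_coefficients(1)] r]
      smooth_on_has_real_derivative[OF smooth_on_deriv[OF open_R smooth_coefficients(2)] r]
      smooth_on_has_real_derivative[OF smooth_on_deriv[OF open_R smooth_coefficients(3)] r]
    by (auto simp: real_differentiable_def)
  have p: "r > 0" "t (arc r) > 0" "deriv t (arc r) < 0"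
    using r t_pos deriv_t_le[of "arc r"] by (auto simp: R_def)
  show "A r \<noteq> 0" using p by (simp add: A_def)
  have "A r - r * B r = 4 * r * deriv t (arc r)"
    using p by (simp add: A_def B_def field_simps)
  then show "A r - r * B r \<noteq> 0" using p by simp
  have "A r - r * C r = t (arc r) * t (arc r) * inverse r * deriv t (arc r)"
    using p by (simp add: A_def C_def field_simps)
  then show "A r - r * C r \<noteq> 0" using p by simp
qed

section \<open>Properties of the chart and the pulled-back metric\<close>

lemma in_U: "z \<in> U \<longleftrightarrow> rho z \<in> R" by (simp add: U_def)

lemma chart_eq: "chart z = rotational_point t q (arc (rho z)) (rho z powr (- 1 / 2) *\<^sub>R z)"
  by (simp add: chart_def rotational_point_def scale_def)

lemma normal_in_hyperboloid:
  assumes "z \<in> U"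
  shows "rho z powr (- 1 / 2) *\<^sub>R z \<in> unit_hyperboloid \<nu>"
proof -
  have p: "rho z > 0" using assms by (simp add: in_U R_def)
  have 1: "rho z powr (- 1 / 2) * rho z powr (- 1 / 2) = inverse (rho z)"
    using p powr_add[of "rho z" "- 1 / 2" "- 1 / 2"] by (simp add: powr_minus)
  have "rho z powr (- 1 / 2) * rho z powr (- 1 / 2) * rho z = 1"
    unfolding 1 using p by simp
  then show ?thesis
    by (simp add: unit_hyperboloid_def lorentz_product_Pair timelike_square_def mult.assoc)
qed

lemma arc_in_I: "z \<in> U \<Longrightarrow> arc (rho z) \<in> I"
  by (simp add: in_U R_def)

lemma param_chart:
  assumes "z \<in> U"
  shows "param_s \<nu> t q I (chart z) = arc (rho z)"
    "param_n \<nu> t q I (chart z) = rho z powr (- 1 / 2) *\<^sub>R z"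
  unfolding chart_eq
  by (rule param_s_eq[OF t_pos inj_t arc_in_I[OF assms] normal_in_hyperboloid[OF assms]]
      param_n_eq[OF t_pos inj_t arc_in_I[OF assms] normal_in_hyperboloid[OF assms]])+

lemma inj_chart: "inj_on chart U"
proof (rule inj_onI)
  fix x y assume *: "x \<in> U" "y \<in> U" "chart x = chart y"
  then have "arc (rho x) = arc (rho y)" "rho x powr (- 1 / 2) *\<^sub>R x = rho y powr (- 1 / 2) *\<^sub>R y"
    using param_chart by metis+
  moreover have "rho y > 0" using *(2) by (simp add: in_U R_def)
  ultimately show "x = y" by (simp add: arc_def)
qed

lemma smooth_chart: "smooth_on U chart"
proof -
  have rho: "smooth_on U rho"
    unfolding timelike_square_def
    by (intro smooth_on_minus smooth_on_bilinear[OF _ bounded_bilinear_lorentz_form] smooth_on_ident open_U)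
  have sub: "rho ` U \<subseteq> R" by (auto simp: in_U)
  have "smooth_on U (\<lambda>z. scale (rho z))" "smooth_on U (\<lambda>z. q (arc (rho z)))"
    by (rule smooth_on_compose[OF open_U open_R smooth_scale rho sub]
        smooth_on_compose[OF open_U open_R smooth_on_arc[OF smooth_q] rho sub])+
  then show ?thesis
    unfolding chart_def
    by (intro smooth_on_Pair smooth_on_bilinear[OF _ bounded_bilinear_scaleR] smooth_on_ident open_U)
qed

text \<open>The derivative of \<open>scale\<close>, with r^(-3/2) written as a cube: in terms of w =
  r^(-1/2), everything below becomes rational in w.\<close>

definition scale' :: "real \<Rightarrow> real" where
  "scale' r = deriv t (arc r) * r powr (- 1 / 2) - t (arc r) * (r powr (- 1 / 2)) ^ 3 / 2"

definition dchart :: "complex ^ 'n \<Rightarrow> complex ^ 'n \<Rightarrow> 'n ambient" where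
  "dchart z v = ((- 2 * h z v * scale' (rho z)) *\<^sub>R z + scale (rho z) *\<^sub>R v,
      - 2 * h z v * deriv q (arc (rho z)))"

lemma chart_has_derivative:
  assumes "z \<in> U"
  shows "(chart has_derivative dchart z) (at z)"
proof -
  have p: "rho z > 0" using assms by (simp add: in_U R_def)
  have arc: "(arc has_real_derivative 1) (at r)" for r
    unfolding arc_def by (auto intro!: derivative_eq_intros)
  have "rho z powr (- 1 / 2 - 1) = (rho z powr (- 1 / 2)) ^ 3"
    using p by (simp add: powr_power)
  then have "(scale has_real_derivative scale' (rho z)) (at (rho z))"
    unfolding scale_def scale'_def using p
    by (auto intro!: derivative_eq_intros DERIV_chain'[OF arc has_deriv_t[OF arc_in_I[OF assms]]])
  note 1 = DERIV_compose_FDERIV[OF this timelike_square_has_derivative]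
  have "((\<lambda>r. q (arc r)) has_real_derivative deriv q (arc (rho z))) (at (rho z))"
    using DERIV_chain'[OF arc has_deriv_q[OF arc_in_I[OF assms]]] by simp
  note 2 = DERIV_compose_FDERIV[OF this timelike_square_has_derivative]
  show ?thesis
    unfolding chart_def dchart_def
    by (rule has_derivative_eq_rhs[OF has_derivative_Pair[OF
            has_derivative_scaleR[OF 1 has_derivative_ident] 2]])
       (auto simp: algebra_simps)
qed

lemma frechet_chart: "z \<in> U \<Longrightarrow> frechet_derivative chart (at z) = dchart z"
  by (rule frechet_derivative_eq[OF chart_has_derivative])

text \<open>As the meridian field is a time-like unit vector orthogonal to the orbits,
  \<open>eta\<close> is -ds, and s = s0 + rho - 1 gives ds = -2 h(z, v). The induced metric is -ds^2
  plus t^2 times the metric of the hyperboloid, whence the -4.\<close>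

lemma eta_chart:
  assumes "z \<in> U"
  shows "eta \<nu> t q I (chart z) (dchart z v) = 2 * h z v"
    "eta_tilde \<nu> t q I (chart z) (dchart z v) = t (arc (rho z)) * inverse (rho z) * h (\<i> *s z) v"
    "lorentz_product \<nu> (dchart z u) (dchart z v)
      = A (rho z) * h u v
      + (t (arc (rho z)) * t (arc (rho z)) * (inverse (rho z) * inverse (rho z)) - 4) * (h z u * h z v)"
proof -
  define w where "w = rho z powr (- 1 / 2)"
  have p: "rho z > 0" using assms by (simp add: in_U R_def)
  have w: "w > 0" using p by (simp add: w_def)
  have "w * w = inverse (rho z)" unfolding w_def
    using p powr_add[of "rho z" "- 1 / 2" "- 1 / 2"] by (simp add: powr_minus)
  then have r: "inverse (rho z) = w * w" and r': "h z z = - inverse (w * w)"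
    by (auto simp: timelike_square_def)
  have s: "scale (rho z) = t (arc (rho z)) * w"
    "scale' (rho z) = deriv t (arc (rho z)) * w - t (arc (rho z)) * w ^ 3 / 2"
    by (simp_all add: scale_def scale'_def w_def)
  have q: "deriv q (arc (rho z)) * deriv q (arc (rho z)) = deriv t (arc (rho z)) * deriv t (arc (rho z)) - 1"
    using natural_parameter[OF arc_in_I[OF assms]] by (simp add: power2_eq_square)
  define T T' Q where "T = t (arc (rho z))" "T' = deriv t (arc (rho z))" "Q = deriv q (arc (rho z))"
  have "eta \<nu> t q I (chart z) (dchart z v) =
    T' * w * (2 * h z v * (T' * w - T * w ^ 3 / 2) * inverse (w * w) + T * w * h z v) - 2 * h z v * (Q * Q)"
    unfolding eta_def xi_def dchart_def param_chart[OF assms] w_def[symmetric] s lorentz_product_Pair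
      T_T'_Q_def
    by (simp add: r' algebra_simps)
  also have "\<dots> = 2 * h z v * (T' * T' - Q * Q)"
    using w by (simp add: field_simps power3_eq_cube)
  also have "\<dots> = 2 * h z v"
    using q by (simp add: T_T'_Q_def)
  finally show "eta \<nu> t q I (chart z) (dchart z v) = 2 * h z v" .
  show "eta_tilde \<nu> t q I (chart z) (dchart z v) = t (arc (rho z)) * inverse (rho z) * h (\<i> *s z) v"
    unfolding eta_tilde_def xi_tilde_def J0_def dchart_def param_chart[OF assms] w_def[symmetric] s r
    by (simp add: lorentz_product_Pair)
  have "lorentz_product \<nu> (dchart z u) (dchart z v) =
    - 4 * (h z u * h z v) * (T' * w - T * w ^ 3 / 2) * ((T' * w - T * w ^ 3 / 2) * inverse (w * w) + T * w)
    + T * T * (w * w) * h u v + 4 * (h z u * h z v) * (Q * Q)"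
    unfolding dchart_def s lorentz_product_Pair T_T'_Q_def
    by (simp add: r' lorentz_form_commute[of \<nu> u z] algebra_simps)
  also have "\<dots> = T * T * (w * w) * h u v
      + (T * T * (w * w * (w * w)) - 4 * (T' * T' - Q * Q)) * (h z u * h z v)"
    using w by (simp add: field_simps power3_eq_cube)
  finally show "lorentz_product \<nu> (dchart z u) (dchart z v)
      = A (rho z) * h u v
      + (t (arc (rho z)) * t (arc (rho z)) * (inverse (rho z) * inverse (rho z)) - 4) * (h z u * h z v)"
    using q by (simp add: A_def r T_T'_Q_def)
qed

lemma kaehler_metric_chart:
  assumes "z \<in> U"
  shows "kaehler_metric \<nu> t q I (chart z) (dchart z u) (dchart z v) = G z u v"
  unfolding kaehler_metric_def eta_chart[OF assms] param_chart[OF assms] G_def B_def C_def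
  by (simp add: algebra_simps)

text \<open>The immersion property needs no rank computation: a vector killed by
  \<open>dchart z\<close> is G-orthogonal to everything, hence zero.\<close>

lemma local_parametrization_chart:
  "local_parametrization (rotational_hypersurface \<nu> t q I) U chart"
  unfolding local_parametrization_def
proof (intro conjI ballI open_U smooth_chart inj_chart)
  show "chart ` U \<subseteq> rotational_hypersurface \<nu> t q I"
    unfolding rotational_hypersurface_def using chart_eq arc_in_I normal_in_hyperboloid by blast
  fix z assume z: "z \<in> U"
  have lin: "linear (dchart z)" using chart_has_derivative[OF z] has_derivative_linear by blast
  have "a = 0" if "dchart z a = 0" for a
  proof (rule G_nondegenerate)
    show "rho z \<in> R" using z by (simp add: in_U)
    have "lorentz_product \<nu> 0 X = 0" for X :: "'n ambient"
      by (cases X) (simp add: zero_prod_def lorentz_product_Pair)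
    then show "G z a y = 0" for y
      unfolding kaehler_metric_chart[OF z, symmetric] that
      by (simp add: kaehler_metric_def eta_def eta_tilde_def lorentz_product_def)
  qed
  then show "inj (frechet_derivative chart (at z))"
    unfolding frechet_chart[OF z] linear_injective_0[OF lin] by blast
qed

text \<open>The only derivative of a coefficient that enters the curvature of a horizontal
  plane.\<close>

lemma deriv_A_one: "deriv A 1 = 2 * t s0 * deriv t s0 - t s0 * t s0"
proof -
  have arc: "(arc has_real_derivative 1) (at r)" for r
    unfolding arc_def by (auto intro!: derivative_eq_intros)
  have "(t has_real_derivative deriv t s0) (at (arc 1))"
    using has_deriv_t[OF s0] by (simp add: arc_def)
  from DERIV_chain'[OF arc this]
  have t: "((\<lambda>r. t (arc r)) has_real_derivative deriv t s0) (at 1)" by simp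
  have "((\<lambda>r. t (arc r) * t (arc r) * inverse r) has_real_derivative
      2 * t s0 * deriv t s0 - t s0 * t s0) (at 1)"
    by (rule derivative_eq_intros t refl | simp add: arc_def)+
  then show ?thesis unfolding A_def[abs_def] by (rule DERIV_imp_deriv)
qed

lemma curvature_horizontal:
  assumes "h z z = - 1" "h z u = 0" "h (\<i> *s z) u = 0" "h u u = 1"
  shows "sectional_curvature (pullback_metric chart (kaehler_metric \<nu> t q I)) z u (\<i> *s u)
     = - 4 * (1 - deriv t s0) / (t s0)\<^sup>2"
    and "frechet_derivative chart (at z) (\<i> *s u)
     = almost_complex_J \<nu> t q I (chart z) (frechet_derivative chart (at z) u)"
    and "z \<in> U"
proof -
  have r: "rho z = 1" using assms(1) by (simp add: timelike_square_def)
  show z: "z \<in> U" by (simp add: in_U r one_in_R)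
  have p: "t s0 > 0" "deriv t s0 < 0" using t_pos s0 deriv_t_le[OF s0] by auto
  have "sectional_curvature (pullback_metric chart (kaehler_metric \<nu> t q I)) z u (\<i> *s u)
    = sectional_curvature G z u (\<i> *s u)"
    by (rule sectional_curvature_cong[OF open_U z])
       (simp add: pullback_metric_def frechet_chart kaehler_metric_chart)
  also have "\<dots> = (2 * deriv A 1 + B 1 - 3 * C 1 + (deriv A 1 + B 1)\<^sup>2 / (A 1 - B 1)) / (A 1)\<^sup>2"
    by (rule sectional_curvature_horizontal[OF r one_in_R assms(2-4)])
  also have "\<dots> = - 4 * (1 - deriv t s0) / (t s0)\<^sup>2"
  proof -
    have e: "A 1 - B 1 = 4 * deriv t s0" "deriv A 1 + B 1 = 2 * deriv t s0 * (t s0 - 2)"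
      by (simp_all add: A_def B_def arc_def deriv_A_one algebra_simps)
    have sq: "(deriv A 1 + B 1)\<^sup>2 / (A 1 - B 1) = deriv t s0 * (t s0 - 2)\<^sup>2"
      unfolding e using p by (simp add: power2_eq_square)
    \<comment> \<open>The terms in t t' and in t' alone cancel; the remaining factor t^2 cancels
      against A^2 = t^4.\<close>
    have num: "2 * deriv A 1 + B 1 - 3 * C 1 + deriv t s0 * (t s0 - 2)\<^sup>2
      = - 4 * (1 - deriv t s0) * (t s0)\<^sup>2"
      by (simp add: A_def B_def C_def arc_def deriv_A_one power2_eq_square algebra_simps)
    have A1: "A 1 = (t s0)\<^sup>2" by (simp add: A_def arc_def power2_eq_square)
    show ?thesis unfolding sq unfolding num unfolding A1 using p by (simp add: power2_eq_square)
  qed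
  finally show "sectional_curvature (pullback_metric chart (kaehler_metric \<nu> t q I)) z u (\<i> *s u)
     = - 4 * (1 - deriv t s0) / (t s0)\<^sup>2" .
  \<comment> \<open>On horizontal vectors \<open>dchart z\<close> only scales, and both
    \<open>eta\<close> components vanish, so J acts there as multiplication by i.\<close>
  show "frechet_derivative chart (at z) (\<i> *s u)
     = almost_complex_J \<nu> t q I (chart z) (frechet_derivative chart (at z) u)"
    unfolding frechet_chart[OF z] almost_complex_J_def proj_D_def eta_chart[OF z] assms(2,3)
    using assms by (simp add: dchart_def J0_def)
qed

end

text \<open>Each s receives its own chart, centred at s, and one plane at a point with
  \<open>rho\<close> = 1 is evaluated there.\<close>

lemma constant_holomorphic_curvature_imp_ode:
  fixes \<nu> :: "'n::finite"
  assumes "CARD('n) \<ge> 2" "type_III \<nu> t q I" "s \<in> I"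
    "constant_holomorphic_curvature (rotational_hypersurface \<nu> t q I)
       (kaehler_metric \<nu> t q I) (almost_complex_J \<nu> t q I) a"
  shows "deriv t s = 1 + a * (t s)\<^sup>2 / 4"
proof -
  interpret type_III_chart \<nu> t q I s using assms by unfold_locales
  \<comment> \<open>A second index provides a vector orthogonal to z and iz, so that D is not
    zero.\<close>
  have "UNIV \<noteq> {\<nu>}"
  proof
    assume "UNIV = {\<nu>}"
    then have "CARD('n) = card {\<nu>}" by simp
    with assms(1) show False by simp
  qed
  then obtain \<mu> where "\<mu> \<noteq> \<nu>" by blast
  define z u :: "complex ^ 'n" where "z = axis \<nu> 1" and "u = axis \<mu> 1"
  have *: "h z z = - 1" "h z u = 0" "h (\<i> *s z) u = 0" "h u u = 1"
    using \<open>\<mu> \<noteq> \<nu>\<close>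
    by (simp_all add: z_def u_def lorentz_form_inner inner_axis_axis inner_axis)
      (simp_all add: axis_def)
  have "u \<noteq> 0" using *(4) by auto
  then have "- 4 * (1 - deriv t s) / (t s)\<^sup>2 = a"
    using assms(4) local_parametrization_chart curvature_horizontal[OF *]
    unfolding constant_holomorphic_curvature_def by metis
  moreover have "t s > 0" using t_pos assms(3) by blast
  ultimately show ?thesis by (simp add: field_simps)
qed

section \<open>The meridian\<close>

text \<open>The arctangent fits because, with w = sqrt (-(8 + a t^2)), the denominator 1 + (w/2)^2
  equals -t' and cancels the factor t' of the chain rule.\<close>

lemma meridian_has_derivative:
  fixes t :: "real \<Rightarrow> real" and a d :: real
  assumes "(t has_real_derivative d) (at s)" "a < 0" "- (8 + a * (t s)\<^sup>2) > 0" "d = 1 + a * (t s)\<^sup>2 / 4"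
  shows "((\<lambda>s. 1 / (- a) * (sqrt (a * (8 + a * (t s)\<^sup>2))
      - 2 * sqrt (- a) * arctan (1 / 2 * sqrt (- (8 + a * (t s)\<^sup>2)))))
    has_real_derivative - sqrt (- a) * t s * sqrt (- (8 + a * (t s)\<^sup>2)) / 4) (at s)"
proof -
  define k w where "k = sqrt (- a)" and "w = sqrt (- (8 + a * (t s)\<^sup>2))"
  have k: "k > 0" "k * k = - a" and w: "w > 0" "w * w = - (8 + a * (t s)\<^sup>2)"
    using assms(2,3) unfolding k_def w_def by (simp_all only: real_sqrt_gt_0_iff) (simp_all add: abs_if)
  \<comment> \<open>Real \<open>sqrt\<close> is odd and so multiplicative on all reals; this is an
    identity of functions of s and can be rewritten under the derivative.\<close>
  have eq: "sqrt (a * (8 + a * (t s)\<^sup>2)) = k * sqrt (- (8 + a * (t s)\<^sup>2))" for s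
    unfolding k_def real_sqrt_mult[symmetric] by (simp add: algebra_simps)
  have "((\<lambda>s. - (8 + a * (t s)\<^sup>2)) has_real_derivative - (2 * a * t s * d)) (at s)"
    by (rule derivative_eq_intros assms(1) refl | simp)+
  note 1 = DERIV_chain'[OF this DERIV_real_sqrt[OF assms(3)]]
  have "inverse (sqrt (- (8 + a * (t s)\<^sup>2))) / 2 * - (2 * a * t s * d) = - (a * t s * d / w)"
    unfolding w_def[symmetric] using w(1) by (simp add: field_simps)
  note dw = DERIV_cong[OF 1 this]
  have "((\<lambda>s. 1 / (- a) * (k * f s - 2 * k * arctan (1 / 2 * f s)))
    has_real_derivative 1 / (- a) * (k * e - 2 * k * (1 / 2 * e * inverse (1 + (1 / 2 * f s)\<^sup>2)))) (at s)"
    if "(f has_real_derivative e) (at s)" for f e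
    by (rule DERIV_cong[OF DERIV_cmult[OF DERIV_diff[OF DERIV_cmult[OF that]
            DERIV_cmult[OF DERIV_chain'[OF DERIV_cmult[OF that] DERIV_arctan]]]]])
       (simp add: mult_ac)
  note derivative = this[OF dw, folded w_def]
  have slope: "1 / (- a) * (k * - (a * t s * d / w)
      - 2 * k * (1 / 2 * - (a * t s * d / w) * inverse (1 + (1 / 2 * w)\<^sup>2))) = - k * t s * w / 4"
  proof -
    have d: "d = - (4 + w * w) / 4" using assms(4) w(2) by simp
    have n: "4 + w * w \<noteq> 0" using w(1) by (simp add: add_pos_pos less_imp_neq[symmetric])
    have i: "inverse (1 + (1 / 2 * w)\<^sup>2) = 4 / (4 + w * w)"
      using n by (simp add: field_simps power2_eq_square)
    have "1 / (- a) * (k * - (a * t s * d / w) - 2 * k * (1 / 2 * - (a * t s * d / w) * (4 / (4 + w * w))))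
      = k * t s * d / w * (1 - 4 / (4 + w * w))"
    proof -
      have X: "a * t s * d / w = a * (t s * d / w)" "k * t s * d / w = k * (t s * d / w)" by simp_all
      have "1 / (- a) * (k * - (a * x) - 2 * k * (1 / 2 * - (a * x) * m)) = k * x * (1 - m)" for x m
        using assms(2) by (simp add: field_simps)
      then show ?thesis unfolding X .
    qed
    also have "1 - 4 / (4 + w * w) = w * w / (4 + w * w)" using n by (simp add: field_simps)
    also have "k * t s * d / w * (w * w / (4 + w * w)) = - k * t s * w / 4"
    proof -
      have "k * t s * (- m / 4) / w * (w * w / m) = - k * t s * w / 4" if "m \<noteq> 0" for m
        using that w(1) by (simp add: field_simps)
      from this[OF n] show ?thesis unfolding d .
    qed
    finally show ?thesis unfolding i .
  qed
  show ?thesis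
    unfolding eq k_def[symmetric] w_def[symmetric] by (rule DERIV_cong[OF derivative slope])
qed

theorem proposition6p12:
  fixes \<nu> :: "'n::finite" and t q :: "real \<Rightarrow> real" and I :: "real set" and a :: real
  assumes "CARD('n) \<ge> 2"
    and "type_III \<nu> t q I"
    and "a < 0"
    and "constant_holomorphic_curvature (rotational_hypersurface \<nu> t q I)
           (kaehler_metric \<nu> t q I) (almost_complex_J \<nu> t q I) a"
  shows "(\<forall>s\<in>I. t s > 2 * sqrt 2 / sqrt (- a)) \<and>
    (\<exists>\<epsilon>\<in>{1, - 1}. \<exists>c. \<forall>s\<in>I.
       q s = \<epsilon> * (1 / (- a) *
         (sqrt (a * (8 + a * (t s)\<^sup>2)) - 2 * sqrt (- a) * arctan (1 / 2 * sqrt (- (8 + a * (t s)\<^sup>2))))) + c)"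
proof -
  note III = assms(2)[unfolded type_III_def]
  have ode: "deriv t s = 1 + a * (t s)\<^sup>2 / 4" if "s \<in> I" for s
    by (rule constant_holomorphic_curvature_imp_ode[OF assms(1,2) that assms(4)])
  have pos: "t s > 0" if "s \<in> I" for s using III that by blast
  have weak: "a * (t s)\<^sup>2 \<le> - 8" if "s \<in> I" for s
    using ode[OF that] III that by force
  have strict: "- (8 + a * (t s)\<^sup>2) > 0" if s: "s \<in> I" for s
  proof -
    interpret type_III_chart \<nu> t q I s using assms(2) s by unfold_locales
    obtain e where "e > 0" "ball s e \<subseteq> I" using open_I s open_contains_ball by blast
    \<comment> \<open>To the right of s the value of t is smaller, so a t^2 is larger there and yet
      at most -8.\<close>
    then have s': "s + e / 2 \<in> I" by (auto simp: dist_real_def subset_iff)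
    have "t (s + e / 2) < t s" using t_decreasing[OF s s'] \<open>e > 0\<close> by simp
    then have "(t (s + e / 2))\<^sup>2 < (t s)\<^sup>2" using pos[OF s'] by (simp add: power_strict_mono)
    then have "a * (t s)\<^sup>2 < a * (t (s + e / 2))\<^sup>2" using assms(3) by simp
    with weak[OF s'] show ?thesis by simp
  qed
  have bound: "t s > 2 * sqrt 2 / sqrt (- a)" if s: "s \<in> I" for s
  proof (rule power2_less_imp_less)
    have "(2 * sqrt 2 / sqrt (- a))\<^sup>2 = 8 / (- a)"
      using assms(3) by (simp add: power_divide power_mult_distrib)
    also have "\<dots> < (t s)\<^sup>2" using strict[OF s] assms(3) by (simp add: field_simps)
    finally show "(2 * sqrt 2 / sqrt (- a))\<^sup>2 < (t s)\<^sup>2" .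
  qed (use pos[OF s] in simp)

  define F where "F s = 1 / (- a) * (sqrt (a * (8 + a * (t s)\<^sup>2))
      - 2 * sqrt (- a) * arctan (1 / 2 * sqrt (- (8 + a * (t s)\<^sup>2))))" for s
  define F' where "F' s = - sqrt (- a) * t s * sqrt (- (8 + a * (t s)\<^sup>2)) / 4" for s
  have dt: "(t has_real_derivative deriv t s) (at s)"
    and dq: "(q has_real_derivative deriv q s) (at s)" if "s \<in> I" for s
    using III that by (auto intro: smooth_on_has_real_derivative)
  have dF: "(F has_real_derivative F' s) (at s)" if "s \<in> I" for s
    unfolding F_def[abs_def] F'_def
    by (rule meridian_has_derivative[OF dt[OF that] assms(3) strict[OF that] ode[OF that]])
  have F'_nonzero: "F' s \<noteq> 0" if "s \<in> I" for s
    using pos[OF that] strict[OF that] assms(3) by (auto simp: F'_def)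
  have squares: "(deriv q s)\<^sup>2 = (F' s)\<^sup>2" if s: "s \<in> I" for s
  proof -
    have "(F' s)\<^sup>2 = - a * (t s)\<^sup>2 * (- (8 + a * (t s)\<^sup>2)) / 16"
      unfolding F'_def using strict[OF s] assms(3)
      by (simp add: power_divide power_mult_distrib)
    \<comment> \<open>t'^2 - 1 = (t' - 1) (t' + 1) = (a t^2 / 4) (2 + a t^2 / 4), which is where the
      factor 8 + a t^2 comes from.\<close>
    also have "\<dots> = (deriv t s)\<^sup>2 - 1"
      unfolding ode[OF s] by (simp add: power2_eq_square algebra_simps)
    also have "\<dots> = (deriv q s)\<^sup>2" using III s by force
    finally show ?thesis by simp
  qed
  have "continuous_on I (deriv q)"
    using III smooth_onD[OF smooth_on_deriv, of I q 0] by simp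
  moreover have "continuous_on I F'"
    unfolding F'_def using III smooth_onD[of I t 0] by (auto intro!: continuous_intros)
  ultimately have cont: "continuous_on I (\<lambda>s. deriv q s / F' s)"
    using F'_nonzero by (intro continuous_on_divide) auto
  have range: "deriv q s / F' s \<in> {1, - 1}" if "s \<in> I" for s
    using squares[OF that] F'_nonzero[OF that] by (auto simp: power2_eq_iff)
  have "connected I" using III is_interval_connected by blast
  moreover have "(\<lambda>s. deriv q s / F' s) ` I \<subseteq> {1, - 1}" using range by blast
  then have "finite ((\<lambda>s. deriv q s / F' s) ` I)" by (rule finite_subset) simp
  \<comment> \<open>A continuous function with finitely many values on a connected set is constant;
    this fixes one sign for the whole interval.\<close>
  ultimately have "(\<lambda>s. deriv q s / F' s) constant_on I"
    by (rule continuous_finite_range_constant[OF _ cont])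
  then obtain e where e: "\<And>s. s \<in> I \<Longrightarrow> deriv q s / F' s = e" unfolding constant_on_def by blast
  obtain \<epsilon> where \<epsilon>: "\<epsilon> \<in> {1, - 1}" "\<And>s. s \<in> I \<Longrightarrow> deriv q s = \<epsilon> * F' s"
  \<comment> \<open>On an empty interval e is unspecified, so the sign is set to 1.\<close>
  proof (cases "I = {}")
    case False
    then have "e \<in> {1, - 1}" using e range by force
    moreover have "deriv q s = e * F' s" if "s \<in> I" for s
      using e[OF that] F'_nonzero[OF that] by (simp add: field_simps)
    ultimately show ?thesis by (rule that)
  qed (use that[of 1] in auto)
  have "((\<lambda>s. q s - \<epsilon> * F s) has_real_derivative 0) (at s within I)" if "s \<in> I" for s
    using DERIV_diff[OF dq[OF that] DERIV_cmult[OF dF[OF that], of \<epsilon>]] \<epsilon>(2)[OF that]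
    by (simp add: has_field_derivative_at_within)
  moreover have "convex I" using III is_interval_convex by blast
  \<comment> \<open>The constant c is a translation of the hypersurface along its axis.\<close>
  ultimately obtain c where "\<And>s. s \<in> I \<Longrightarrow> q s - \<epsilon> * F s = c"
    using has_field_derivative_zero_constant[of I "\<lambda>s. q s - \<epsilon> * F s"] by blast
  then have "\<forall>s\<in>I. q s = \<epsilon> * F s + c" by force
  then show ?thesis using bound \<epsilon>(1) unfolding F_def by blast
qed

end
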